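(* Let $d\ge2$ and let $(X_i)$ be as in the context with $X_i\in\mathcal L^{d+1}$ and $\mathbb E X_i=0$. If $\sum_{k=0}^\infty k^{d-1}\delta_{d+1}(k)<\infty$, then $$\sum_{k_1,\ldots,k_d\in\mathbb Z}\big|\mathrm{Cum}(X_0,X_{k_1},\ldots,X_{k_d})\big|<\infty.$$
   Context: $(\epsilon_i)_{i\in\mathbb Z}$ i.i.d., $X_i=g(\ldots,\epsilon_{i-1},\epsilon_i)$ with $g$ measurable, a stationary process. $\|X\|_p=(\mathbb E|X|^p)^{1/p}$. With $(\epsilon_i')$ an independent i.i.d. copy and $X_i^*$ equal to $X_i$ with $\epsilon_0$ replaced by $\epsilon_0'$, $\delta_p(i)=\|X_i-X_i^*\|_p$ for $i\ge0$. For a random vector $(Y_1,\ldots,Y_k)$ with $\|Y_i\|_k<\infty$, the joint cumulant is $\mathrm{Cum}(Y_1,\ldots,Y_k)=\sum(-1)^{p-1}(p-1)!\prod_{j=1}^p\mathbb E\prod_{i\in\nu_j}Y_i$, the sum over all partitions $\{\nu_1,\ldots,\nu_p\}$ of $\{1,\ldots,k\}$ into nonempty blocks. *)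

theory Defs
  imports "HOL-Probability.Probability" "HOL-Library.FuncSet"
begin

definition cumulant :: "'a measure \<Rightarrow> nat set \<Rightarrow> (nat \<Rightarrow> 'a \<Rightarrow> real) \<Rightarrow> real" where
  "cumulant M I Y =
     (\<Sum>P\<in>{P. partition_on I P}.
        (-1) ^ (card P - 1) * fact (card P - 1) *
        (\<Prod>B\<in>P. (\<integral>\<omega>. (\<Prod>i\<in>B. Y i \<omega>) \<partial>M)))"

text \<open>Physical dependence measure delta_p(i) = || X_i - X_i^* ||_p, computed on
  the canonical coupling space: coordinates Some t carry epsilon_t, coordinate None
  carries the independent copy epsilon_0'. Here X_i = g(j \<mapsto> epsilon_{i-j}),
  j = 0,1,2,... is the lag, and mu is the common law of the innovations.\<close>
definition phys_dep :: "'e measure \<Rightarrow> ((nat \<Rightarrow> 'e) \<Rightarrow> real) \<Rightarrow> nat \<Rightarrow> nat \<Rightarrow> real" where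
  "phys_dep \<mu> g p i =
     (\<integral>e. \<bar>g (\<lambda>j. e (Some (int i - int j)))
             - g (\<lambda>j. if j = i then e None else e (Some (int i - int j)))\<bar> ^ p
        \<partial>(PiM (UNIV :: int option set) (\<lambda>_. \<mu>))) powr (1 / real p)"

end

theory Submission
  imports Defs
begin

text \<open>
  On the space of innovation sequences write \<open>X\<^sub>t\<close> as the sum over \<open>m \<ge> 0\<close> of the innovations
  \<open>D m t = E[X\<^sub>t | \<epsilon>\<^sub>s, s \<ge> t - m] - E[X\<^sub>t | \<epsilon>\<^sub>s, s > t - m]\<close>. By Jensen's inequality the
  \<open>L\<^sup>p\<close> norm of \<open>D m t\<close> is at most \<open>\<delta>\<^sub>p(m)\<close>, with \<open>p = d + 1\<close>, and \<open>D m t\<close> is a function of the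
  innovations at the times \<open>t - m, ..., t\<close> only. Expand the cumulant multilinearly and consider the
  cumulant of \<open>D (m\<^sub>0) (t\<^sub>0), ..., D (m\<^sub>d) (t\<^sub>d)\<close> with left endpoints \<open>i\<^sub>j = t\<^sub>j - m\<^sub>j\<close>. If the smallest
  \<open>i\<^sub>j\<close> is attained only once, integrating out the innovation at that time shows that it vanishes; if the
  intervals \<open>[i\<^sub>j, t\<^sub>j]\<close> split into two separated groups, it vanishes by independence. So all
  \<open>i\<^sub>j\<close> lie within distance \<open>S = m\<^sub>0 + ... + m\<^sub>d\<close> of each other and two of them coincide. With
  \<open>t\<^sub>0 = 0\<close> fixed this leaves at most a constant times \<open>(2 S + 1)^(d-1)\<close> choices of the times, a number
  dominated by the sum of the \<open>(1 + m\<^sub>j)^(d-1)\<close>, and the moment assumption on \<open>\<delta>\<^sub>p\<close> gives a finite total.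
  The coincidence of two endpoints is what saves one power of \<open>S\<close>.
\<close>

subsection \<open>Cumulants of set functions\<close>

definition set_cumulant :: "('i set \<Rightarrow> real) \<Rightarrow> 'i set \<Rightarrow> real" where
  "set_cumulant m I =
     (\<Sum>P\<in>{P. partition_on I P}. (-1) ^ (card P - 1) * fact (card P - 1) * (\<Prod>B\<in>P. m B))"

lemma cumulant_eq_set_cumulant:
  "cumulant M I Y = set_cumulant (\<lambda>B. \<integral>\<omega>. (\<Prod>i\<in>B. Y i \<omega>) \<partial>M) I"
  by (simp add: cumulant_def set_cumulant_def)

lemma card_partition_blocks_avoiding:
  assumes "finite I" "partition_on I Q" "i \<in> I"
  shows "card {C \<in> Q. i \<notin> C} = card Q - 1"
proof -
  obtain B where B: "B \<in> Q" "i \<in> B"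
    using assms by (auto dest: partition_onD1)
  have "{C \<in> Q. i \<notin> C} = Q - {B}"
    using B partition_onD2[OF assms(2)] by (auto simp: disjoint_def)
  moreover have "finite Q" using assms finite_elements by blast
  ultimately show ?thesis using B by simp
qed

lemma partition_on_Diff_block:
  assumes "partition_on I Q" "C \<in> Q"
  shows "partition_on (I - C) (Q - {C})"
proof (rule partition_onI)
  have disj: "B \<inter> C = {}" if "B \<in> Q - {C}" for B
    using that assms partition_onD2[OF assms(1)] by (auto simp: disjoint_def)
  show "\<Union>(Q - {C}) = I - C"
    using disj partition_onD1[OF assms(1)] by auto
  show "disjnt p q" if "p \<in> Q - {C}" "q \<in> Q - {C}" "p \<noteq> q" for p q
    using that partition_onD2[OF assms(1)] by (auto simp: disjoint_def disjnt_def)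
  show "{} \<notin> Q - {C}"
    using partition_onD3[OF assms(1)] by auto
qed

lemma partition_on_insert_compl:
  assumes "partition_on B P" "B \<subset> I"
  shows "partition_on I (insert (I - B) P)" "I - B \<notin> P"
proof -
  have *: "\<Union>P = B" "{} \<notin> P" "disjoint P"
    using assms by (auto simp: partition_on_def)
  have sub: "p \<subseteq> B" if "p \<in> P" for p using that * by auto
  show "I - B \<notin> P" using sub[of "I - B"] assms(2) by auto
  show "partition_on I (insert (I - B) P)"
  proof (rule partition_onI)
    show "\<Union>(insert (I - B) P) = I" using * assms(2) by auto
    show "disjnt p q" if "p \<in> insert (I - B) P" "q \<in> insert (I - B) P" "p \<noteq> q" for p q
    proof (cases "p \<in> P \<and> q \<in> P")
      case True
      then show ?thesis using *(3) that(3) by (simp add: pairwise_def)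
    next
      case False
      then show ?thesis using that sub by (auto simp: disjnt_def)
    qed
    show "{} \<notin> insert (I - B) P"
      using *(2) assms(2) by auto
  qed
qed

text \<open>Splitting off a block \<open>C\<close> with \<open>i \<notin> C\<close> from a partition with \<open>q\<close> blocks can be done in
  \<open>q - 1\<close> ways, and \<open>(q - 1) * (-1)^(q-2) * (q-2)!\<close> cancels the weight \<open>(-1)^(q-1) * (q-1)!\<close>.\<close>

lemma set_cumulant_recursion:
  fixes m :: "'i set \<Rightarrow> real"
  assumes fin: "finite I" and i: "i \<in> I" and m0: "m {} = 1"
  shows "m I = (\<Sum>B\<in>{B. i \<in> B \<and> B \<subseteq> I}. set_cumulant m B * m (I - B))"
proof -
  define w :: "nat \<Rightarrow> real" where "w q = (-1) ^ (q - 1) * fact (q - 1)" for q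
  have sc: "set_cumulant m B = (\<Sum>P\<in>{P. partition_on B P}. w (card P) * prod m P)" for B
    by (simp add: set_cumulant_def w_def)
  have finP: "finite {P. partition_on B P}" if "B \<subseteq> I" for B
    using that fin by (meson finite_subset finitely_many_partition_on)
  have finQ: "finite Q" if "partition_on I Q" for Q
    using that fin finite_elements by blast
  have finB: "finite {B. i \<in> B \<and> B \<subset> I}"
    by (rule finite_subset[of _ "Pow I"]) (use fin in auto)
  have eq: "{B. i \<in> B \<and> B \<subseteq> I} = insert I {B. i \<in> B \<and> B \<subset> I}"
    using i by auto
  have "(\<Sum>B\<in>{B. i \<in> B \<and> B \<subset> I}. set_cumulant m B * m (I - B))
      = (\<Sum>B\<in>{B. i \<in> B \<and> B \<subset> I}. \<Sum>P\<in>{P. partition_on B P}. w (card P) * prod m P * m (I - B))"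
    by (simp add: sc sum_distrib_right)
  also have "\<dots> = (\<Sum>(B,P)\<in>Sigma {B. i \<in> B \<and> B \<subset> I} (\<lambda>B. {P. partition_on B P}).
        w (card P) * prod m P * m (I - B))"
    using finB finP by (subst sum.Sigma) auto
  \<comment> \<open>A proper subset \<open>B\<close> containing \<open>i\<close>, together with a
    partition of \<open>B\<close>, is the same as a partition of \<open>I\<close> with a marked
    block avoiding \<open>i\<close>, namely \<open>I - B\<close>. The partition of \<open>B\<close>
    has one block fewer.\<close>
  also have "\<dots> = (\<Sum>(Q,C)\<in>Sigma {Q. partition_on I Q} (\<lambda>Q. {C \<in> Q. i \<notin> C}). w (card Q - 1) * prod m Q)"
  proof (rule sum.reindex_bij_witness[where i = "\<lambda>(Q,C). (I - C, Q - {C})" and j = "\<lambda>(B,P). (insert (I - B) P, I - B)"],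
      goal_cases)
    case (1 a)
    then obtain B P where a: "a = (B,P)" "i \<in> B" "B \<subset> I" "partition_on B P" by auto
    show ?case using a partition_on_insert_compl[OF a(4,3)] by auto
  next
    case (2 a)
    then obtain B P where a: "a = (B,P)" "i \<in> B" "B \<subset> I" "partition_on B P" by auto
    show ?case using a partition_on_insert_compl[OF a(4,3)] by auto
  next
    case (3 b)
    then obtain Q C where b: "b = (Q,C)" "partition_on I Q" "C \<in> Q" "i \<notin> C" by auto
    have "C \<subseteq> I" using b partition_onD1 by blast
    then have "I - (I - C) = C" by auto
    then show ?case using b by auto
  next
    case (4 b)
    then obtain Q C where b: "b = (Q,C)" "partition_on I Q" "C \<in> Q" "i \<notin> C" by auto
    have "C \<subseteq> I" "C \<noteq> {}" using b partition_onD1[OF b(2)] partition_onD3[OF b(2)] by auto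
    then show ?case using b i partition_on_Diff_block[OF b(2,3)] by auto
  next
    case (5 a)
    then obtain B P where a: "a = (B,P)" "i \<in> B" "B \<subset> I" "partition_on B P" by auto
    have "finite P" using a fin by (meson finite_elements finite_subset psubset_imp_subset)
    then show ?case using a partition_on_insert_compl[OF a(4,3)] by simp
  qed
  also have "\<dots> = (\<Sum>Q\<in>{Q. partition_on I Q}. real (card Q - 1) * w (card Q - 1) * prod m Q)"
    using fin finP[of I] finQ
    by (subst sum.Sigma[symmetric]) (auto simp: card_partition_blocks_avoiding[OF fin _ i] mult.assoc)
  finally have "(\<Sum>B\<in>{B. i \<in> B \<and> B \<subseteq> I}. set_cumulant m B * m (I - B)) =
     (\<Sum>Q\<in>{Q. partition_on I Q}. w (card Q) * prod m Q)
     + (\<Sum>Q\<in>{Q. partition_on I Q}. real (card Q - 1) * w (card Q - 1) * prod m Q)"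
    using finB unfolding eq by (subst sum.insert) (auto simp: m0 sc)
  also have "\<dots> = (\<Sum>Q\<in>{Q. partition_on I Q}. (w (card Q) + real (card Q - 1) * w (card Q - 1)) * prod m Q)"
    by (simp add: sum.distrib[symmetric] algebra_simps)
  \<comment> \<open>With at least two blocks the two weights cancel. With a single block the
    truncated difference \<open>card Q - 1\<close> is 0 and only \<open>w 1 = 1\<close>
    remains.\<close>
  also have "\<dots> = (\<Sum>Q\<in>{Q. partition_on I Q}. if Q = {I} then m I else 0)"
  proof (intro sum.cong refl)
    fix Q assume "Q \<in> {Q. partition_on I Q}"
    then have Q: "partition_on I Q" by simp
    have "Q \<noteq> {}" using Q i partition_onD1 by fastforce
    then have c: "card Q \<ge> 1" using finQ[OF Q] by (simp add: Suc_leI card_gt_0_iff)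
    show "(w (card Q) + real (card Q - 1) * w (card Q - 1)) * prod m Q = (if Q = {I} then m I else 0)"
    proof (cases "card Q = 1")
      case True
      then obtain B where B: "Q = {B}" by (auto simp: card_1_singleton_iff)
      then have "B = I" using partition_onD1[OF Q] by simp
      then show ?thesis using B by (simp add: w_def)
    next
      case False
      then obtain q where q: "card Q = Suc (Suc q)" using c that[of "card Q - 2"] by linarith
      have "Q \<noteq> {I}" using False by auto
      then show ?thesis using q by (simp add: w_def algebra_simps)
    qed
  qed
  also have "\<dots> = m I"
    using finP[of I] i partition_on_space[of I] by auto
  finally show ?thesis by simp
qed

text \<open>Strong induction on \<open>I\<close>, with the recursion applied at some
  \<open>i\<close> in \<open>A\<close>. A proper subset containing \<open>i\<close> and meeting
  \<open>B\<close> contributes nothing by induction. The subsets of \<open>I \<inter> A\<close> add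
  up, by the recursion for \<open>I \<inter> A\<close>, to
  \<open>m (I \<inter> A) * m (I \<inter> B)\<close>, which is \<open>m I\<close>. So nothing is
  left for the term \<open>set_cumulant m I\<close>.\<close>

lemma set_cumulant_indep_eq_0:
  fixes m :: "'i set \<Rightarrow> real"
  assumes "finite I" "A \<inter> B = {}" "I \<subseteq> A \<union> B" "I \<inter> A \<noteq> {}" "I \<inter> B \<noteq> {}"
    and "m {} = 1" and "\<And>C. C \<subseteq> I \<Longrightarrow> m C = m (C \<inter> A) * m (C \<inter> B)"
  shows "set_cumulant m I = 0"
  using assms(1,3-)
proof (induction I rule: finite_psubset_induct)
  case (psubset I)
  note hyps = psubset.prems(1-4) and fac = psubset.prems(5)
  obtain i where i: "i \<in> I" "i \<in> A" using hyps by auto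
  have IA: "finite (I \<inter> A)" "i \<in> I \<inter> A" using psubset.hyps i by auto
  let ?S = "{C. i \<in> C \<and> C \<subseteq> I}" and ?T = "{C. i \<in> C \<and> C \<subseteq> I \<inter> A}"
  have finS: "finite ?S" using psubset.hyps by auto
  have "m I = set_cumulant m I * m {} + (\<Sum>C\<in>?S - {I}. set_cumulant m C * m (I - C))"
    unfolding set_cumulant_recursion[of I i m, OF psubset.hyps i(1) hyps(4)] using i finS
    by (subst sum.remove[of _ I]) auto
  also have "(\<Sum>C\<in>?S - {I}. set_cumulant m C * m (I - C)) = (\<Sum>C\<in>?T. set_cumulant m C * m (I - C))"
  proof (rule sum.mono_neutral_right)
    show "finite (?S - {I})" using finS by simp
    show "?T \<subseteq> ?S - {I}" using hyps assms(2) by auto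
    show "\<forall>C\<in>?S - {I} - ?T. set_cumulant m C * m (I - C) = 0"
    proof
      fix C assume C: "C \<in> ?S - {I} - ?T"
      have "set_cumulant m C = 0"
        using C i hyps by (intro psubset.IH fac) auto
      then show "set_cumulant m C * m (I - C) = 0" by simp
    qed
  qed
  also have "\<dots> = (\<Sum>C\<in>?T. set_cumulant m C * m (I \<inter> A - C)) * m (I \<inter> B)"
    unfolding sum_distrib_right
  proof (intro sum.cong refl)
    fix C assume C: "C \<in> ?T"
    have "(I - C) \<inter> A = I \<inter> A - C" "(I - C) \<inter> B = I \<inter> B" using C assms(2) by auto
    then show "set_cumulant m C * m (I - C) = set_cumulant m C * m (I \<inter> A - C) * m (I \<inter> B)"
      using fac[of "I - C"] by simp
  qed
  also have "\<dots> = m (I \<inter> A) * m (I \<inter> B)"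
    using set_cumulant_recursion[of "I \<inter> A" i m] IA hyps(4) by presburger
  also have "\<dots> = m I" using fac[of I] by simp
  finally show ?case using hyps by simp
qed

lemma set_cumulant_eq_0_block:
  assumes "finite I" "j \<in> I" "\<And>C. C \<subseteq> I \<Longrightarrow> j \<in> C \<Longrightarrow> m C = 0"
  shows "set_cumulant m I = 0"
  unfolding set_cumulant_def
proof (rule sum.neutral, rule ballI)
  fix P assume "P \<in> {P. partition_on I P}"
  then have P: "partition_on I P" by simp
  obtain B where B: "B \<in> P" "j \<in> B" using P assms(2) by (auto dest: partition_onD1)
  have "m B = 0" using B P partition_onD1[OF P] by (intro assms(3)) auto
  then have "prod m P = 0" using B finite_elements[OF assms(1) P] by auto
  then show "(- 1) ^ (card P - 1) * fact (card P - 1) * prod m P = 0" by simp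
qed

text \<open>Exactly one block of a partition contains \<open>j\<close>, so each summand is linear in
  the values of \<open>m\<close> on the sets containing \<open>j\<close>. This is additivity of the
  cumulant in slot \<open>j\<close>.\<close>

lemma set_cumulant_add:
  assumes fin: "finite I" and j: "j \<in> I"
    and in_block: "\<And>C. C \<subseteq> I \<Longrightarrow> j \<in> C \<Longrightarrow> m C = m1 C + m2 C"
    and off_block: "\<And>C. C \<subseteq> I \<Longrightarrow> j \<notin> C \<Longrightarrow> m1 C = m C \<and> m2 C = m C"
  shows "set_cumulant m I = set_cumulant m1 I + set_cumulant m2 I"
  unfolding set_cumulant_def sum.distrib[symmetric]
proof (rule sum.cong[OF refl])
  fix P assume "P \<in> {P. partition_on I P}"
  then have P: "partition_on I P" by simp
  have finP: "finite P" using finite_elements[OF fin P] .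
  obtain B where B: "B \<in> P" "j \<in> B" using P j by (auto dest: partition_onD1)
  have sub: "C \<subseteq> I" if "C \<in> P" for C using that partition_onD1[OF P] by auto
  have off: "j \<notin> C" if "C \<in> P - {B}" for C
    using that B partition_onD2[OF P] by (auto simp: disjoint_def)
  have 1: "prod m1 (P - {B}) = prod m (P - {B})" and 2: "prod m2 (P - {B}) = prod m (P - {B})"
    using off sub off_block by (auto intro!: prod.cong)
  have "prod m P = prod m1 P + prod m2 P"
    using finP B 1 2 in_block[OF sub[OF B(1)] B(2)] by (simp add: prod.remove[of P B] distrib_right)
  then show "(- 1) ^ (card P - 1) * fact (card P - 1) * prod m P =
      (- 1) ^ (card P - 1) * fact (card P - 1) * prod m1 P +
      (- 1) ^ (card P - 1) * fact (card P - 1) * prod m2 P"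
    by (simp add: distrib_left)
qed

text \<open>Signs are dropped and each block pays one factor \<open>c\<close>. The factors
  \<open>a i\<close> recombine over the blocks of any partition to \<open>prod a I\<close>, so the
  constant is independent of \<open>a\<close>.\<close>

definition cumulant_const :: "'i set \<Rightarrow> real \<Rightarrow> real" where
  "cumulant_const I c = (\<Sum>P\<in>{P. partition_on I P}. fact (card P - 1) * c ^ card P)"

lemma cumulant_const_nonneg: "c \<ge> 0 \<Longrightarrow> cumulant_const I c \<ge> 0"
  unfolding cumulant_const_def by (intro sum_nonneg) auto

lemma abs_set_cumulant_le:
  assumes fin: "finite I" and c: "c \<ge> 0" and a: "\<And>i. i \<in> I \<Longrightarrow> a i \<ge> (0::real)"
    and m: "\<And>C. C \<subseteq> I \<Longrightarrow> \<bar>m C\<bar> \<le> c * prod a C"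
  shows "\<bar>set_cumulant m I\<bar> \<le> cumulant_const I c * prod a I"
proof -
  have "\<bar>set_cumulant m I\<bar> \<le> (\<Sum>P\<in>{P. partition_on I P}. fact (card P - 1) * c ^ card P * prod a I)"
    unfolding set_cumulant_def
  proof (rule order.trans[OF sum_abs], rule sum_mono)
    fix P assume "P \<in> {P. partition_on I P}"
    then have P: "partition_on I P" by simp
    have finP: "finite P" using finite_elements[OF fin P] .
    have sub: "C \<subseteq> I" if "C \<in> P" for C using that partition_onD1[OF P] by auto
    have "\<bar>prod m P\<bar> \<le> (\<Prod>C\<in>P. c * prod a C)"
      unfolding abs_prod using sub m by (intro prod_mono) auto
    also have "\<dots> = c ^ card P * (\<Prod>C\<in>P. prod a C)"
      by (simp add: prod.distrib)
    also have "(\<Prod>C\<in>P. prod a C) = prod a (\<Union>P)"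
      using sub fin partition_onD2[OF P]
      by (subst prod.Union_disjoint) (auto simp: disjoint_def intro: finite_subset)
    also have "\<Union>P = I" using partition_onD1[OF P] by simp
    finally show "\<bar>(- 1) ^ (card P - 1) * fact (card P - 1) * prod m P\<bar>
        \<le> fact (card P - 1) * c ^ card P * prod a I"
      by (simp add: abs_mult power_abs mult.assoc)
  qed
  then show ?thesis by (simp add: cumulant_const_def sum_distrib_right)
qed

subsection \<open>Cumulants of functions in \<open>L\<^sup>p\<close>\<close>

text \<open>Functions rather than classes modulo null sets, because dependence on coordinates is
  later treated pointwise. Bounds are stated for the p-th powers, which avoids taking roots.\<close>

definition Lp_fun :: "'a measure \<Rightarrow> nat \<Rightarrow> ('a \<Rightarrow> real) set" where
  "Lp_fun M p = {f \<in> borel_measurable M. integrable M (\<lambda>x. \<bar>f x\<bar> ^ p)}"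

lemma Lp_funD:
  assumes "f \<in> Lp_fun M p"
  shows "f \<in> borel_measurable M" "integrable M (\<lambda>x. \<bar>f x\<bar> ^ p)"
  using assms by (auto simp: Lp_fun_def)

lemma abs_add_power_le: "\<bar>x + y :: real\<bar> ^ p \<le> 2 ^ p * (\<bar>x\<bar> ^ p + \<bar>y\<bar> ^ p)"
proof -
  have "\<bar>x + y\<bar> ^ p \<le> (2 * max \<bar>x\<bar> \<bar>y\<bar>) ^ p"
    by (intro power_mono) auto
  also have "\<dots> \<le> 2 ^ p * (\<bar>x\<bar> ^ p + \<bar>y\<bar> ^ p)"
    by (simp add: power_mult_distrib max_def)
  finally show ?thesis .
qed

lemma Lp_fun_zero [simp]: "(\<lambda>x. 0) \<in> Lp_fun M (Suc p)"
  by (simp add: Lp_fun_def)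

lemma Lp_fun_uminus: "f \<in> Lp_fun M p \<Longrightarrow> (\<lambda>x. - f x) \<in> Lp_fun M p"
  by (simp add: Lp_fun_def)

lemma Lp_fun_add:
  assumes "f \<in> Lp_fun M p" "g \<in> Lp_fun M p"
  shows "(\<lambda>x. f x + g x) \<in> Lp_fun M p"
proof -
  note [measurable] = Lp_funD(1)[OF assms(1)] Lp_funD(1)[OF assms(2)]
  have "integrable M (\<lambda>x. \<bar>f x + g x\<bar> ^ p)"
    by (rule Bochner_Integration.integrable_bound[where f = "\<lambda>x. 2 ^ p * (\<bar>f x\<bar> ^ p + \<bar>g x\<bar> ^ p)"])
       (use assms abs_add_power_le in \<open>auto simp: Lp_fun_def\<close>)
  then show ?thesis by (simp add: Lp_fun_def)
qed

lemma Lp_fun_diff: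
  assumes "f \<in> Lp_fun M p" "g \<in> Lp_fun M p"
  shows "(\<lambda>x. f x - g x) \<in> Lp_fun M p"
  using Lp_fun_add[OF assms(1) Lp_fun_uminus[OF assms(2)]] by simp

lemma Lp_fun_sum:
  assumes "\<And>i. i \<in> F \<Longrightarrow> f i \<in> Lp_fun M (Suc p)"
  shows "(\<lambda>x. \<Sum>i\<in>F. f i x) \<in> Lp_fun M (Suc p)"
  using assms by (induction F rule: infinite_finite_induct) (auto intro: Lp_fun_add)

text \<open>Every factor is at most \<open>z\<close>, the maximum of 1 and all factors. As
  \<open>z\<close> is at least 1, its exponent may be raised from \<open>card C\<close> to
  \<open>p\<close>, and \<open>z ^ p\<close> is either 1 or one of the summands.\<close>

lemma prod_le_one_plus_sum_power:
  fixes y :: "'i \<Rightarrow> real"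
  assumes "finite C" "card C \<le> p" "\<And>j. j \<in> C \<Longrightarrow> 0 \<le> y j"
  shows "(\<Prod>j\<in>C. y j) \<le> 1 + (\<Sum>j\<in>C. y j ^ p)"
proof -
  define z where "z = Max (insert 1 (y ` C))"
  have zy: "y j \<le> z" if "j \<in> C" for j
    using assms(1) that by (auto simp: z_def)
  have z1: "1 \<le> z" using assms(1) by (auto simp: z_def)
  have "(\<Prod>j\<in>C. y j) \<le> (\<Prod>j\<in>C. z)"
    using assms(3) zy by (intro prod_mono) auto
  also have "\<dots> \<le> z ^ p"
    using z1 assms(2) by (simp add: power_increasing)
  also have "\<dots> \<le> 1 + (\<Sum>j\<in>C. y j ^ p)"
  proof -
    have nn: "0 \<le> (\<Sum>j\<in>C. y j ^ p)" using assms(3) by (intro sum_nonneg) auto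
    have "z \<in> insert 1 (y ` C)" unfolding z_def using assms(1) by (intro Max_in) auto
    then consider "z = 1" | j where "j \<in> C" "z = y j" by auto
    then show ?thesis
    proof cases
      case 1
      then show ?thesis using nn by simp
    next
      case 2
      then have "z ^ p \<le> (\<Sum>j\<in>C. y j ^ p)"
        using assms by (auto intro!: member_le_sum)
      then show ?thesis by simp
    qed
  qed
  finally show ?thesis .
qed

section \<open>Bounds, multilinearity and continuity of cumulants\<close>

context prob_space
begin

lemma integrable_prod_Lp:
  assumes C: "finite C" "card C \<le> p" and Y: "\<And>j. j \<in> C \<Longrightarrow> Y j \<in> Lp_fun M p"
  shows "integrable M (\<lambda>\<omega>. \<Prod>j\<in>C. Y j \<omega>)"
proof (rule Bochner_Integration.integrable_bound[where f = "\<lambda>\<omega>. 1 + (\<Sum>j\<in>C. \<bar>Y j \<omega>\<bar> ^ p)"])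
  show "integrable M (\<lambda>\<omega>. 1 + (\<Sum>j\<in>C. \<bar>Y j \<omega>\<bar> ^ p))"
    using Y by (intro Bochner_Integration.integrable_add Bochner_Integration.integrable_sum) (auto dest: Lp_funD)
  show "(\<lambda>\<omega>. \<Prod>j\<in>C. Y j \<omega>) \<in> borel_measurable M"
    using Y by (intro borel_measurable_prod) (auto dest: Lp_funD)
  show "AE \<omega> in M. norm (\<Prod>j\<in>C. Y j \<omega>) \<le> norm (1 + (\<Sum>j\<in>C. \<bar>Y j \<omega>\<bar> ^ p))"
    using prod_le_one_plus_sum_power[OF C, of "\<lambda>j. \<bar>Y j _\<bar>"]
    by (intro AE_I2) (simp add: abs_prod order.trans[OF _ abs_ge_self])
qed

lemma integrable_Lp:
  assumes "f \<in> Lp_fun M p" "1 \<le> p"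
  shows "integrable M f"
  using integrable_prod_Lp[of "{()}" p "\<lambda>_. f"] assms by simp

text \<open>A crude form of Hoelder's inequality, with a constant that is not sharp.\<close>

lemma abs_moment_le:
  assumes C: "finite C" "card C \<le> p" and Y: "\<And>j. j \<in> C \<Longrightarrow> Y j \<in> Lp_fun M p"
    and a: "\<And>j. j \<in> C \<Longrightarrow> 0 < a j" "\<And>j. j \<in> C \<Longrightarrow> (\<integral>\<omega>. \<bar>Y j \<omega>\<bar> ^ p \<partial>M) \<le> a j ^ p"
  shows "\<bar>\<integral>\<omega>. (\<Prod>j\<in>C. Y j \<omega>) \<partial>M\<bar> \<le> (1 + real p) * prod a C"
proof -
  have pos: "0 < prod a C" using a by (intro prod_pos) auto
  have "\<bar>\<integral>\<omega>. (\<Prod>j\<in>C. Y j \<omega>) \<partial>M\<bar> \<le> (\<integral>\<omega>. \<bar>\<Prod>j\<in>C. Y j \<omega>\<bar> \<partial>M)"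
    by (rule integral_abs_bound)
  also have "\<dots> \<le> (\<integral>\<omega>. prod a C * (1 + (\<Sum>j\<in>C. \<bar>Y j \<omega>\<bar> ^ p / a j ^ p)) \<partial>M)"
  proof (rule integral_mono)
    show "integrable M (\<lambda>\<omega>. \<bar>\<Prod>j\<in>C. Y j \<omega>\<bar>)"
      using integrable_prod_Lp[OF C Y] by simp
    show "integrable M (\<lambda>\<omega>. prod a C * (1 + (\<Sum>j\<in>C. \<bar>Y j \<omega>\<bar> ^ p / a j ^ p)))"
      using Y by (intro integrable_mult_right Bochner_Integration.integrable_add
          Bochner_Integration.integrable_sum integrable_divide) (auto dest: Lp_funD)
    fix \<omega>
    \<comment> \<open>After division by \<open>a j\<close> each factor has p-th moment at most 1, so
      the integral of the right-hand side is at most \<open>1 + card C\<close>.\<close>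
    have "(\<Prod>j\<in>C. \<bar>Y j \<omega>\<bar> / a j) \<le> 1 + (\<Sum>j\<in>C. (\<bar>Y j \<omega>\<bar> / a j) ^ p)"
      using a by (intro prod_le_one_plus_sum_power C) (simp add: less_imp_le)
    then have "\<bar>\<Prod>j\<in>C. Y j \<omega>\<bar> / prod a C \<le> 1 + (\<Sum>j\<in>C. \<bar>Y j \<omega>\<bar> ^ p / a j ^ p)"
      by (simp add: abs_prod prod_dividef power_divide)
    then show "\<bar>\<Prod>j\<in>C. Y j \<omega>\<bar> \<le> prod a C * (1 + (\<Sum>j\<in>C. \<bar>Y j \<omega>\<bar> ^ p / a j ^ p))"
      using pos by (simp add: pos_divide_le_eq mult.commute)
  qed
  also have "\<dots> = prod a C * (1 + (\<Sum>j\<in>C. (\<integral>\<omega>. \<bar>Y j \<omega>\<bar> ^ p \<partial>M) / a j ^ p))"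
    using Lp_funD(2)[OF Y] by (simp add: prob_space Bochner_Integration.integral_sum)
  also have "\<dots> \<le> prod a C * (1 + (\<Sum>j\<in>C. 1))"
    using pos a by (intro mult_left_mono add_left_mono sum_mono) (auto simp: divide_le_eq)
  also have "\<dots> \<le> prod a C * (1 + real p)"
    using pos C by (intro mult_left_mono) auto
  finally show ?thesis by (simp add: mult.commute)
qed

lemma abs_cumulant_le:
  assumes I: "finite I" "card I \<le> p" and Y: "\<And>j. j \<in> I \<Longrightarrow> Y j \<in> Lp_fun M p"
    and a: "\<And>j. j \<in> I \<Longrightarrow> 0 < a j" "\<And>j. j \<in> I \<Longrightarrow> (\<integral>\<omega>. \<bar>Y j \<omega>\<bar> ^ p \<partial>M) \<le> a j ^ p"
  shows "\<bar>cumulant M I Y\<bar> \<le> cumulant_const I (1 + real p) * prod a I"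
  unfolding cumulant_eq_set_cumulant
proof (rule abs_set_cumulant_le[OF I(1)])
  fix C assume C: "C \<subseteq> I"
  then have "finite C" "card C \<le> p"
    using I finite_subset card_mono[OF I(1) C] by auto
  then show "\<bar>\<integral>\<omega>. (\<Prod>i\<in>C. Y i \<omega>) \<partial>M\<bar> \<le> (1 + real p) * prod a C"
    using C Y a by (intro abs_moment_le) auto
qed (use a in \<open>auto intro: less_imp_le\<close>)

lemma cumulant_add:
  assumes I: "finite I" "card I \<le> p" "j \<in> I"
    and Y: "\<And>i. i \<in> I \<Longrightarrow> i \<noteq> j \<Longrightarrow> Y i \<in> Lp_fun M p" and UV: "U \<in> Lp_fun M p" "V \<in> Lp_fun M p"
  shows "cumulant M I (Y(j := \<lambda>\<omega>. U \<omega> + V \<omega>)) = cumulant M I (Y(j := U)) + cumulant M I (Y(j := V))"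
  unfolding cumulant_eq_set_cumulant
proof (rule set_cumulant_add[OF I(1,3)], goal_cases)
  case (1 C)
  have fin: "finite C" "card C \<le> p"
    using I finite_subset 1 card_mono[OF I(1) 1(1)] by auto
  have *: "(\<Prod>i\<in>C. (Y(j := W)) i \<omega>) = W \<omega> * (\<Prod>i\<in>C - {j}. Y i \<omega>)" for W \<omega>
  proof -
    have "(\<Prod>i\<in>C - {j}. (Y(j := W)) i \<omega>) = (\<Prod>i\<in>C - {j}. Y i \<omega>)"
      by (intro prod.cong) auto
    then show ?thesis using fin 1 by (simp add: prod.remove[of C j])
  qed
  have int: "integrable M (\<lambda>\<omega>. \<Prod>i\<in>C. (Y(j := W)) i \<omega>)" if "W \<in> Lp_fun M p" for W
    using 1 Y that by (intro integrable_prod_Lp[OF fin]) auto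
  show ?case
    using int[OF UV(1)] int[OF UV(2)] unfolding * by (simp add: distrib_right)
next
  case (2 C)
  have "(\<Prod>i\<in>C. (Y(j := W)) i \<omega>) = (\<Prod>i\<in>C. Y i \<omega>)" for W \<omega>
    using 2 by (intro prod.cong) auto
  then show ?case by simp
qed

lemma cumulant_zero_slot:
  assumes "finite I" "j \<in> I"
  shows "cumulant M I (Y(j := \<lambda>\<omega>. 0)) = 0"
  unfolding cumulant_eq_set_cumulant
proof (rule set_cumulant_eq_0_block[OF assms])
  fix C assume "C \<subseteq> I" "j \<in> C"
  then have "(\<Prod>i\<in>C. (Y(j := \<lambda>\<omega>. 0)) i \<omega>) = 0" for \<omega>
    using assms by (intro prod_zero) (auto intro: finite_subset)
  then show "(\<integral>\<omega>. (\<Prod>i\<in>C. (Y(j := \<lambda>\<omega>. 0)) i \<omega>) \<partial>M) = 0" by simp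
qed

lemma cumulant_sum_slot:
  assumes I: "finite I" "card I \<le> Suc p" "j \<in> I"
    and Y: "\<And>i. i \<in> I \<Longrightarrow> i \<noteq> j \<Longrightarrow> Y i \<in> Lp_fun M (Suc p)"
    and D: "\<And>n. n \<in> F \<Longrightarrow> D n \<in> Lp_fun M (Suc p)"
  shows "cumulant M I (Y(j := \<lambda>\<omega>. \<Sum>n\<in>F. D n \<omega>)) = (\<Sum>n\<in>F. cumulant M I (Y(j := D n)))"
  using D
proof (induction F rule: infinite_finite_induct)
  case (insert n F)
  have "cumulant M I (Y(j := \<lambda>\<omega>. D n \<omega> + (\<Sum>n\<in>F. D n \<omega>))) =
     cumulant M I (Y(j := D n)) + cumulant M I (Y(j := \<lambda>\<omega>. \<Sum>n\<in>F. D n \<omega>))"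
    using insert.prems by (intro cumulant_add[OF I Y] Lp_fun_sum) auto
  then show ?case using insert by (simp del: fun_upd_apply)
qed (use cumulant_zero_slot[OF I(1,3)] in auto)

lemma cumulant_cong:
  assumes "\<And>j. j \<in> I \<Longrightarrow> Y j = Z j"
  shows "cumulant M I Y = cumulant M I Z"
  unfolding cumulant_def
proof (intro sum.cong refl arg_cong2[where f = "(*)"] prod.cong Bochner_Integration.integral_cong)
  fix P B x i assume "P \<in> {P. partition_on I P}" "B \<in> P" "i \<in> B"
  then have "i \<in> I" by (auto simp: partition_on_def)
  then show "Y i x = Z i x" using assms by simp
qed

text \<open>Only the slots in \<open>J\<close> are expanded and the others hold arbitrary functions
  \<open>Z\<close>. In the induction on \<open>J\<close> the still unexpanded sum of the new slot is
  hidden in \<open>Z'\<close>.\<close>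

lemma cumulant_multilinear_aux:
  assumes I: "finite I" "card I \<le> Suc p" and J: "finite J" "J \<subseteq> I"
    and D: "\<And>j n. j \<in> I \<Longrightarrow> n \<in> F \<Longrightarrow> D j n \<in> Lp_fun M (Suc p)"
    and Z: "\<And>j. j \<in> I \<Longrightarrow> Z j \<in> Lp_fun M (Suc p)"
  shows "cumulant M I (\<lambda>j. if j \<in> J then (\<lambda>\<omega>. \<Sum>n\<in>F. D j n \<omega>) else Z j) =
    (\<Sum>m\<in>J \<rightarrow>\<^sub>E F. cumulant M I (\<lambda>j. if j \<in> J then D j (m j) else Z j))"
  using J Z
proof (induction J arbitrary: Z rule: finite_induct)
  case (insert a J)
  define Z' where "Z' = Z(a := \<lambda>\<omega>. \<Sum>n\<in>F. D a n \<omega>)"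
  have aI: "a \<in> I" using insert.prems by simp
  have Z': "Z' j \<in> Lp_fun M (Suc p)" if "j \<in> I" for j
    using that insert.prems D by (auto simp: Z'_def intro: Lp_fun_sum)
  have "cumulant M I (\<lambda>j. if j \<in> insert a J then (\<lambda>\<omega>. \<Sum>n\<in>F. D j n \<omega>) else Z j)
     = cumulant M I (\<lambda>j. if j \<in> J then (\<lambda>\<omega>. \<Sum>n\<in>F. D j n \<omega>) else Z' j)"
    using insert.hyps by (intro cumulant_cong) (auto simp: Z'_def)
  also have "\<dots> = (\<Sum>m\<in>J \<rightarrow>\<^sub>E F. cumulant M I (\<lambda>j. if j \<in> J then D j (m j) else Z' j))"
    using insert.prems Z' by (intro insert.IH) auto
  also have "\<dots> = (\<Sum>m\<in>J \<rightarrow>\<^sub>E F. \<Sum>n\<in>F. cumulant M I ((\<lambda>j. if j \<in> J then D j (m j) else Z j)(a := D a n)))"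
  proof (intro sum.cong refl)
    fix m assume m: "m \<in> J \<rightarrow>\<^sub>E F"
    have "(\<lambda>j. if j \<in> J then D j (m j) else Z' j) =
        (\<lambda>j. if j \<in> J then D j (m j) else Z j)(a := \<lambda>\<omega>. \<Sum>n\<in>F. D a n \<omega>)"
      using insert.hyps by (auto simp: Z'_def fun_eq_iff)
    moreover have "cumulant M I ((\<lambda>j. if j \<in> J then D j (m j) else Z j)(a := \<lambda>\<omega>. \<Sum>n\<in>F. D a n \<omega>)) =
       (\<Sum>n\<in>F. cumulant M I ((\<lambda>j. if j \<in> J then D j (m j) else Z j)(a := D a n)))"
      using m D aI insert.prems by (intro cumulant_sum_slot[OF I]) (auto simp: PiE_mem)
    ultimately show "cumulant M I (\<lambda>j. if j \<in> J then D j (m j) else Z' j) =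
       (\<Sum>n\<in>F. cumulant M I ((\<lambda>j. if j \<in> J then D j (m j) else Z j)(a := D a n)))"
      by simp
  qed
  also have "\<dots> = (\<Sum>(n,m)\<in>F \<times> (J \<rightarrow>\<^sub>E F). cumulant M I ((\<lambda>j. if j \<in> J then D j (m j) else Z j)(a := D a n)))"
    by (subst sum.swap) (simp add: sum.cartesian_product)
  also have "\<dots> = (\<Sum>(n,m)\<in>F \<times> (J \<rightarrow>\<^sub>E F). cumulant M I (\<lambda>j. if j \<in> insert a J then D j ((m(a := n)) j) else Z j))"
    using insert.hyps by (intro sum.cong refl) (auto intro!: cumulant_cong)
  also have "\<dots> = (\<Sum>m\<in>(\<lambda>(n,m). m(a := n)) ` (F \<times> (J \<rightarrow>\<^sub>E F)).
      cumulant M I (\<lambda>j. if j \<in> insert a J then D j (m j) else Z j))"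
    using inj_combinator[OF insert.hyps(2), of "\<lambda>_. F"]
    by (subst sum.reindex) (auto simp: o_def case_prod_unfold)
  also have "(\<lambda>(n,m). m(a := n)) ` (F \<times> (J \<rightarrow>\<^sub>E F)) = insert a J \<rightarrow>\<^sub>E F"
    by (simp add: PiE_insert_eq)
  finally show ?case .
qed simp

lemma cumulant_multilinear:
  assumes I: "finite I" "card I \<le> Suc p"
    and D: "\<And>j n. j \<in> I \<Longrightarrow> n \<in> F \<Longrightarrow> D j n \<in> Lp_fun M (Suc p)"
  shows "cumulant M I (\<lambda>j \<omega>. \<Sum>n\<in>F. D j n \<omega>) = (\<Sum>m\<in>I \<rightarrow>\<^sub>E F. cumulant M I (\<lambda>j. D j (m j)))"
proof -
  have "cumulant M I (\<lambda>j \<omega>. \<Sum>n\<in>F. D j n \<omega>) =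
      cumulant M I (\<lambda>j. if j \<in> I then (\<lambda>\<omega>. \<Sum>n\<in>F. D j n \<omega>) else (\<lambda>\<omega>. 0))"
    by (rule cumulant_cong) simp
  also have "\<dots> = (\<Sum>m\<in>I \<rightarrow>\<^sub>E F. cumulant M I (\<lambda>j. if j \<in> I then D j (m j) else (\<lambda>\<omega>. 0)))"
    by (rule cumulant_multilinear_aux[OF I I(1) subset_refl D]) auto
  also have "\<dots> = (\<Sum>m\<in>I \<rightarrow>\<^sub>E F. cumulant M I (\<lambda>j. D j (m j)))"
    by (intro sum.cong refl cumulant_cong) simp
  finally show ?thesis .
qed

text \<open>The slots are changed one at a time. Changing slot \<open>k\<close> costs a cumulant
  with the difference \<open>R n\<close> in that slot. It is small by
  \<open>abs_cumulant_le\<close>, since \<open>bnd\<close> keeps the moments of the other slots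
  bounded uniformly in \<open>n\<close>.\<close>

lemma cumulant_tendsto:
  assumes I: "finite I" "card I \<le> Suc p"
    and Y: "\<And>j. j \<in> I \<Longrightarrow> Y j \<in> Lp_fun M (Suc p)"
    and Yn: "\<And>j n. j \<in> I \<Longrightarrow> Yn n j \<in> Lp_fun M (Suc p)"
    and bnd: "\<And>j n. j \<in> I \<Longrightarrow> (\<integral>\<omega>. \<bar>Yn n j \<omega>\<bar> ^ Suc p \<partial>M) \<le> (\<integral>\<omega>. \<bar>Y j \<omega>\<bar> ^ Suc p \<partial>M)"
    and lim: "\<And>j. j \<in> I \<Longrightarrow> (\<lambda>n. \<integral>\<omega>. \<bar>Yn n j \<omega> - Y j \<omega>\<bar> ^ Suc p \<partial>M) \<longlonglongrightarrow> 0"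
  shows "(\<lambda>n. cumulant M I (Yn n)) \<longlonglongrightarrow> cumulant M I Y"
proof -
  \<comment> \<open>The summand 1 makes \<open>a j\<close> at least 1, so that
    \<open>a j \<le> a j ^ Suc p\<close> bounds the moment without a root.\<close>
  define a where "a j = 1 + (\<integral>\<omega>. \<bar>Y j \<omega>\<bar> ^ Suc p \<partial>M)" for j
  have a1: "1 \<le> a j" for j by (simp add: a_def)
  have a_pow: "(\<integral>\<omega>. \<bar>Y j \<omega>\<bar> ^ Suc p \<partial>M) \<le> a j ^ Suc p" for j
  proof -
    have "(\<integral>\<omega>. \<bar>Y j \<omega>\<bar> ^ Suc p \<partial>M) \<le> a j" by (simp add: a_def)
    also have "\<dots> \<le> a j ^ Suc p" using a1[of j] power_increasing[of 1 "Suc p" "a j"] by simp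
    finally show ?thesis .
  qed
  have *: "(\<lambda>n. cumulant M I (\<lambda>j. if j \<in> J then Yn n j else Y j)) \<longlonglongrightarrow> cumulant M I Y"
    if "finite J" "J \<subseteq> I" for J
    using that
  proof (induction J rule: finite_induct)
    case (insert k J)
    have kI: "k \<in> I" using insert.prems by simp
    define W where "W n j = (if j \<in> J then Yn n j else Y j)" for n j
    have W: "W n j \<in> Lp_fun M (Suc p)" "(\<integral>\<omega>. \<bar>W n j \<omega>\<bar> ^ Suc p \<partial>M) \<le> a j ^ Suc p" if "j \<in> I" for n j
      using Y[OF that] Yn[OF that] a_pow[of j] order.trans[OF bnd[OF that] a_pow[of j]]
      by (auto simp: W_def simp del: power_Suc)
    define R where "R n = (\<lambda>\<omega>. Yn n k \<omega> - Y k \<omega>)" for n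
    have R: "R n \<in> Lp_fun M (Suc p)" for n
      unfolding R_def using kI Y Yn by (intro Lp_fun_diff) auto
    have split: "cumulant M I (\<lambda>j. if j \<in> insert k J then Yn n j else Y j) =
        cumulant M I (W n) + cumulant M I ((W n)(k := R n))" for n
    proof -
      have "cumulant M I (\<lambda>j. if j \<in> insert k J then Yn n j else Y j) =
          cumulant M I ((W n)(k := \<lambda>\<omega>. Y k \<omega> + R n \<omega>))"
        by (intro cumulant_cong) (auto simp: W_def R_def)
      also have "\<dots> = cumulant M I ((W n)(k := Y k)) + cumulant M I ((W n)(k := R n))"
        using kI W Y R by (intro cumulant_add[OF I]) auto
      also have "(W n)(k := Y k) = W n" using insert.hyps by (auto simp: W_def)
      finally show ?thesis .
    qed
    have "(\<lambda>n. cumulant M I ((W n)(k := R n))) \<longlonglongrightarrow> 0"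
    proof (rule LIMSEQ_I)
      fix e :: real assume e: "e > 0"
      define K where "K = cumulant_const I (1 + real (Suc p)) * prod a (I - {k})"
      have "0 \<le> prod a (I - {k})" using a1 by (intro prod_nonneg) (auto intro: order.trans[OF zero_le_one])
      then have K: "K \<ge> 0" unfolding K_def by (intro mult_nonneg_nonneg cumulant_const_nonneg) auto
      \<comment> \<open>\<open>K\<close> may be 0, hence \<open>K + 1\<close> in the
        denominator.\<close>
      define \<eta> where "\<eta> = e / (2 * (K + 1))"
      have eta: "\<eta> > 0" "K * \<eta> < e"
      proof -
        show "\<eta> > 0" using e K by (simp add: \<eta>_def)
        have "K * \<eta> \<le> (K + 1) * \<eta>" using \<open>\<eta> > 0\<close> by (intro mult_right_mono) auto
        also have "\<dots> = e / 2" using K by (simp add: \<eta>_def field_simps)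
        finally show "K * \<eta> < e" using e by simp
      qed
      have "eventually (\<lambda>n. (\<integral>\<omega>. \<bar>R n \<omega>\<bar> ^ Suc p \<partial>M) < \<eta> ^ Suc p) sequentially"
        using order_tendstoD(2)[OF lim[OF kI], of "\<eta> ^ Suc p"] eta by (simp add: R_def)
      then obtain n0 where n0: "\<And>n. n \<ge> n0 \<Longrightarrow> (\<integral>\<omega>. \<bar>R n \<omega>\<bar> ^ Suc p \<partial>M) < \<eta> ^ Suc p"
        by (auto simp: eventually_sequentially)
      have "norm (cumulant M I ((W n)(k := R n)) - 0) < e" if "n \<ge> n0" for n
      proof -
        have "\<bar>cumulant M I ((W n)(k := R n))\<bar> \<le> cumulant_const I (1 + real (Suc p)) * prod (a(k := \<eta>)) I"
          using W R n0[OF that] eta(1) less_le_trans[OF zero_less_one a1]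
          by (intro abs_cumulant_le[OF I]) (auto simp del: power_Suc intro: less_imp_le)
        also have "prod (a(k := \<eta>)) I = \<eta> * prod a (I - {k})"
          using I kI by (subst prod.remove[of _ k]) (auto intro!: prod.cong)
        also have "cumulant_const I (1 + real (Suc p)) * (\<eta> * prod a (I - {k})) = K * \<eta>"
          by (simp add: K_def)
        also have "\<dots> < e" by (rule eta)
        finally show ?thesis by (simp del: fun_upd_apply)
      qed
      then show "\<exists>no. \<forall>n\<ge>no. norm (cumulant M I ((W n)(k := R n)) - 0) < e" by blast
    qed
    moreover have "(\<lambda>n. cumulant M I (W n)) \<longlonglongrightarrow> cumulant M I Y"
      using insert by (simp add: W_def[abs_def])
    ultimately show ?case unfolding split using tendsto_add by fastforce
  qed simp
  have "(\<lambda>n. cumulant M I (\<lambda>j. if j \<in> I then Yn n j else Y j)) = (\<lambda>n. cumulant M I (Yn n))"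
    by (intro ext cumulant_cong) simp
  then show ?thesis using *[OF I(1) subset_refl] by simp
qed

end

section \<open>Jensen's inequality and partial integration\<close>

lemma convex_on_abs_power:
  assumes "1 \<le> p"
  shows "convex_on UNIV (\<lambda>x :: real. \<bar>x\<bar> ^ p)"
proof (rule convex_onI)
  fix t x y :: real assume t: "0 < t" "t < 1"
  have c: "convex_on {0 :: real..} (\<lambda>x. x ^ p)"
    by (cases "even p") (auto intro: convex_power_odd convex_on_subset[OF convex_power_even])
  have "\<bar>(1 - t) * x + t * y\<bar> ^ p \<le> ((1 - t) * \<bar>x\<bar> + t * \<bar>y\<bar>) ^ p"
    using t by (intro power_mono order.trans[OF abs_triangle_ineq]) (auto simp: abs_mult)
  also have "\<dots> \<le> (1 - t) * \<bar>x\<bar> ^ p + t * \<bar>y\<bar> ^ p"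
    using convex_onD[OF c, of t "\<bar>x\<bar>" "\<bar>y\<bar>"] t by simp
  finally show "\<bar>(1 - t) *\<^sub>R x + t *\<^sub>R y\<bar> ^ p \<le> (1 - t) * \<bar>x\<bar> ^ p + t * \<bar>y\<bar> ^ p" by simp
qed simp

lemma (in prob_space) abs_expectation_power_le:
  assumes "f \<in> Lp_fun M p" "1 \<le> p"
  shows "\<bar>expectation f\<bar> ^ p \<le> expectation (\<lambda>x. \<bar>f x\<bar> ^ p)"
  by (rule jensens_inequality[where I = UNIV])
     (use assms in \<open>auto intro: integrable_Lp convex_on_abs_power dest: Lp_funD\<close>)

text \<open>Jensen's inequality on almost every section, followed by Fubini's theorem: integrating
  out one component does not increase the p-th moment.\<close>

lemma (in pair_prob_space) Lp_fun_integral_fst: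
  fixes f :: "'a \<times> 'b \<Rightarrow> real"
  assumes f: "f \<in> Lp_fun (M1 \<Otimes>\<^sub>M M2) p" and p: "1 \<le> p"
  shows "(\<lambda>x. \<integral>y. f (x, y) \<partial>M2) \<in> Lp_fun M1 p"
    and "(\<integral>x. \<bar>\<integral>y. f (x, y) \<partial>M2\<bar> ^ p \<partial>M1) \<le> (\<integral>z. \<bar>f z\<bar> ^ p \<partial>(M1 \<Otimes>\<^sub>M M2))"
proof -
  note [measurable] = Lp_funD(1)[OF f]
  have int: "integrable (M1 \<Otimes>\<^sub>M M2) (\<lambda>z. \<bar>f z\<bar> ^ p)" using f by (rule Lp_funD)
  have ae: "AE x in M1. \<bar>\<integral>y. f (x, y) \<partial>M2\<bar> ^ p \<le> (\<integral>y. \<bar>f (x, y)\<bar> ^ p \<partial>M2)"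
    using AE_integrable_fst'[OF int]
  proof (eventually_elim, goal_cases)
    case (1 x)
    show ?case
    \<comment> \<open>\<open>x\<close> is not known here to lie in the space, so the section may
      fail to be measurable. Its integral then has the default value 0.\<close>
    proof (cases "(\<lambda>y. f (x, y)) \<in> borel_measurable M2")
      case True
      then have "(\<lambda>y. f (x, y)) \<in> Lp_fun M2 p" using 1 by (simp add: Lp_fun_def)
      from M2.abs_expectation_power_le[OF this p] show ?thesis .
    next
      case False
      then have "(\<integral>y. f (x, y) \<partial>M2) = 0"
        using not_integrable_integral_eq borel_measurable_integrable by blast
      then show ?thesis using p by (simp add: power_0_left)
    qed
  qed
  have I2: "integrable M1 (\<lambda>x. \<integral>y. \<bar>f (x, y)\<bar> ^ p \<partial>M2)" by (rule integrable_fst'[OF int])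
  have "(\<lambda>x. \<integral>y. f (x, y) \<partial>M2) \<in> borel_measurable M1"
    by (rule M2.borel_measurable_lebesgue_integral) simp
  moreover have I1: "integrable M1 (\<lambda>x. \<bar>\<integral>y. f (x, y) \<partial>M2\<bar> ^ p)"
    by (rule Bochner_Integration.integrable_bound[OF I2])
       (use ae in \<open>auto elim!: eventually_mono intro: order.trans[OF _ abs_ge_self]\<close>)
  ultimately show "(\<lambda>x. \<integral>y. f (x, y) \<partial>M2) \<in> Lp_fun M1 p" by (simp add: Lp_fun_def)
  show "(\<integral>x. \<bar>\<integral>y. f (x, y) \<partial>M2\<bar> ^ p \<partial>M1) \<le> (\<integral>z. \<bar>f z\<bar> ^ p \<partial>(M1 \<Otimes>\<^sub>M M2))"
    using integral_mono_AE[OF I1 I2 ae] integral_fst'[OF int] by simp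
qed

subsection \<open>Averaging out the past on the sequence space\<close>

locale iid_space = E: prob_space \<mu> for \<mu> :: "'e measure"
begin

abbreviation W :: "(int \<Rightarrow> 'e) measure" where "W \<equiv> PiM UNIV (\<lambda>_. \<mu>)"

sublocale W: product_prob_space "\<lambda>_. \<mu>" "UNIV :: int set"
  by unfold_locales

sublocale WW: pair_prob_space W W
  by unfold_locales

text \<open>Distinct coordinates picked from two independent copies are again i.i.d. The Boolean
  component of \<open>\<phi> s\<close> says which copy supplies coordinate \<open>s\<close>. The
  index type is arbitrary, so that the lemma serves both \<open>splice\<close> and the coupling on
  \<open>int option\<close> in \<open>phys_dep\<close>.\<close>

lemma distr_select:
  fixes \<phi> :: "'j \<Rightarrow> bool \<times> int"
  defines "S \<equiv> \<lambda>(\<omega>, \<omega>') s. if fst (\<phi> s) then \<omega>' (snd (\<phi> s)) else \<omega> (snd (\<phi> s))"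
  assumes inj: "inj \<phi>"
  shows "S \<in> measurable (W \<Otimes>\<^sub>M W) (PiM UNIV (\<lambda>_ :: 'j. \<mu>))"
    and "distr (W \<Otimes>\<^sub>M W) (PiM UNIV (\<lambda>_ :: 'j. \<mu>)) S = PiM UNIV (\<lambda>_. \<mu>)"
proof -
  show S[measurable]: "S \<in> measurable (W \<Otimes>\<^sub>M W) (PiM UNIV (\<lambda>_ :: 'j. \<mu>))"
  proof (rule measurable_PiM_single')
    show "(\<lambda>\<omega>. S \<omega> i) \<in> measurable (W \<Otimes>\<^sub>M W) \<mu>" for i
      by (cases "fst (\<phi> i)") (simp_all add: S_def case_prod_unfold)
    show "S \<in> space (W \<Otimes>\<^sub>M W) \<rightarrow> UNIV \<rightarrow>\<^sub>E space \<mu>"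
      by (auto simp: S_def space_pair_measure space_PiM PiE_iff)
  qed
  interpret J: product_prob_space "\<lambda>_. \<mu>" "UNIV :: 'j set" by unfold_locales
  show "distr (W \<Otimes>\<^sub>M W) (PiM UNIV (\<lambda>_ :: 'j. \<mu>)) S = PiM UNIV (\<lambda>_. \<mu>)"
  proof (rule J.PiM_eq)
    fix J :: "'j set" and F assume J: "finite J" and F: "\<And>j. j \<in> J \<Longrightarrow> F j \<in> sets \<mu>"
    \<comment> \<open>\<open>K b\<close> collects the coordinates of copy \<open>b\<close> that the
      cylinder restricts, and \<open>C b\<close> is the resulting cylinder in that copy. The
      preimage under \<open>S\<close> is the rectangle of the two.\<close>
    define K where "K b = {u. (b, u) \<in> \<phi> ` J}" for b
    define C where "C b = {\<omega> \<in> space W. \<forall>u\<in>K b. \<omega> u \<in> F (inv \<phi> (b, u))}" for b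
    have K: "finite (K b)" for b
      unfolding K_def using J by (intro finite_vimageI[of "\<phi> ` J" "Pair b", unfolded vimage_def]) (auto simp: inj_def)
    have FK: "F (inv \<phi> (b, u)) \<in> sets \<mu>" if "u \<in> K b" for b u
      using that F inj by (auto simp: K_def)
    have Csets: "C b \<in> sets W" for b
      unfolding C_def using K FK by measurable
    have eC: "emeasure W (C b) = (\<Prod>u\<in>K b. emeasure \<mu> (F (inv \<phi> (b, u))))" for b
      unfolding C_def using K FK by (intro W.emeasure_PiM_Collect) auto
    have "S -` prod_emb UNIV (\<lambda>_. \<mu>) J (Pi\<^sub>E J F) \<inter> space (W \<Otimes>\<^sub>M W) = C False \<times> C True"
    proof (intro set_eqI iffI)
      fix z assume z: "z \<in> S -` prod_emb UNIV (\<lambda>_. \<mu>) J (Pi\<^sub>E J F) \<inter> space (W \<Otimes>\<^sub>M W)"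
      obtain \<omega> \<omega>' where [simp]: "z = (\<omega>, \<omega>')" by (cases z)
      have *: "(if fst (\<phi> s) then \<omega>' (snd (\<phi> s)) else \<omega> (snd (\<phi> s))) \<in> F s" if "s \<in> J" for s
        using z that by (auto simp: prod_emb_def S_def PiE_iff)
      have "\<omega> u \<in> F (inv \<phi> (False, u))" if u: "u \<in> K False" for u
      proof -
        obtain s where s: "s \<in> J" "\<phi> s = (False, u)" using u by (auto simp: K_def)
        then have "inv \<phi> (False, u) = s" using inj by (metis inv_f_f)
        then show ?thesis using *[OF s(1)] s by simp
      qed
      moreover have "\<omega>' u \<in> F (inv \<phi> (True, u))" if u: "u \<in> K True" for u
      proof -
        obtain s where s: "s \<in> J" "\<phi> s = (True, u)" using u by (auto simp: K_def)
        then have "inv \<phi> (True, u) = s" using inj by (metis inv_f_f)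
        then show ?thesis using *[OF s(1)] s by simp
      qed
      ultimately show "z \<in> C False \<times> C True"
        using z by (auto simp: C_def space_pair_measure)
    next
      fix z assume z: "z \<in> C False \<times> C True"
      obtain \<omega> \<omega>' where [simp]: "z = (\<omega>, \<omega>')" by (cases z)
      have sp: "z \<in> space (W \<Otimes>\<^sub>M W)" using z by (auto simp: C_def space_pair_measure)
      have "S z s \<in> F s" if s: "s \<in> J" for s
      proof (cases "\<phi> s")
        case (Pair b u)
        then have u: "u \<in> K b" using s by (force simp: K_def)
        have "inv \<phi> (b, u) = s" using inj Pair by (metis inv_f_f)
        then show ?thesis using z u Pair by (cases b) (auto simp: C_def S_def)
      qed
      then show "z \<in> S -` prod_emb UNIV (\<lambda>_. \<mu>) J (Pi\<^sub>E J F) \<inter> space (W \<Otimes>\<^sub>M W)"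
        using sp measurable_space[OF S sp] by (auto simp: prod_emb_def space_PiM PiE_iff)
    qed
    then have "emeasure (distr (W \<Otimes>\<^sub>M W) (PiM UNIV (\<lambda>_ :: 'j. \<mu>)) S) (prod_emb UNIV (\<lambda>_. \<mu>) J (Pi\<^sub>E J F))
       = emeasure W (C False) * emeasure W (C True)"
      using J F Csets by (subst emeasure_distr) (auto simp: sets_PiM_I W.emeasure_pair_measure_Times)
    also have "\<dots> = (\<Prod>b\<in>UNIV. \<Prod>u\<in>K b. emeasure \<mu> (F (inv \<phi> (b, u))))"
      by (simp add: eC UNIV_bool)
    also have "\<dots> = (\<Prod>q\<in>Sigma UNIV K. emeasure \<mu> (F (inv \<phi> q)))"
      using K by (subst prod.Sigma) (auto intro!: prod.cong)
    also have "Sigma UNIV K = \<phi> ` J" by (auto simp: K_def)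
    also have "(\<Prod>q\<in>\<phi> ` J. emeasure \<mu> (F (inv \<phi> q))) = (\<Prod>s\<in>J. emeasure \<mu> (F s))"
      using inj by (subst prod.reindex) (auto intro: inj_on_subset)
    finally show "emeasure (distr (W \<Otimes>\<^sub>M W) (PiM UNIV (\<lambda>_ :: 'j. \<mu>)) S) (prod_emb UNIV (\<lambda>_. \<mu>) J (Pi\<^sub>E J F))
       = (\<Prod>s\<in>J. emeasure \<mu> (F s))" .
  qed simp
qed

definition splice :: "int \<Rightarrow> (int \<Rightarrow> 'e) \<Rightarrow> (int \<Rightarrow> 'e) \<Rightarrow> int \<Rightarrow> 'e" where
  "splice i \<omega> \<omega>' s = (if i \<le> s then \<omega> s else \<omega>' s)"

text \<open>A version of the conditional expectation of \<open>f\<close> given the coordinates \<open>\<ge> i\<close>,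
  defined pointwise so that it depends exactly, not just almost surely, on these coordinates.
  At the null set of points where the integral does not exist it has the junk value 0.\<close>

definition avg :: "int \<Rightarrow> ((int \<Rightarrow> 'e) \<Rightarrow> real) \<Rightarrow> (int \<Rightarrow> 'e) \<Rightarrow> real" where
  "avg i f \<omega> = (\<integral>\<omega>'. f (splice i \<omega> \<omega>') \<partial>W)"

lemma measurable_splice [measurable]: "(\<lambda>z. splice i (fst z) (snd z)) \<in> measurable (W \<Otimes>\<^sub>M W) W"
  and distr_splice: "distr (W \<Otimes>\<^sub>M W) W (\<lambda>z. splice i (fst z) (snd z)) = W"
proof -
  let ?\<phi> = "\<lambda>s :: int. (s < i, s)"
  have inj: "inj ?\<phi>" by (auto simp: inj_def)
  have eq: "(\<lambda>(\<omega>, \<omega>') s. if fst (?\<phi> s) then \<omega>' (snd (?\<phi> s)) else \<omega> (snd (?\<phi> s)))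
      = (\<lambda>z. splice i (fst z) (snd z))"
    by (auto simp: splice_def fun_eq_iff)
  show "(\<lambda>z. splice i (fst z) (snd z)) \<in> measurable (W \<Otimes>\<^sub>M W) W"
    and "distr (W \<Otimes>\<^sub>M W) W (\<lambda>z. splice i (fst z) (snd z)) = W"
    using distr_select[OF inj] unfolding eq by auto
qed

lemma splice_in_space: "\<omega> \<in> space W \<Longrightarrow> \<omega>' \<in> space W \<Longrightarrow> splice i \<omega> \<omega>' \<in> space W"
  by (auto simp: space_PiM splice_def PiE_iff)

lemma integrable_splice:
  fixes f :: "(int \<Rightarrow> 'e) \<Rightarrow> real"
  assumes "integrable W f"
  shows "integrable (W \<Otimes>\<^sub>M W) (\<lambda>z. f (splice i (fst z) (snd z)))"
  by (rule integrable_distr[OF measurable_splice]) (simp add: distr_splice assms)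

lemma integral_splice:
  fixes f :: "(int \<Rightarrow> 'e) \<Rightarrow> real"
  assumes "f \<in> borel_measurable W"
  shows "(\<integral>z. f (splice i (fst z) (snd z)) \<partial>(W \<Otimes>\<^sub>M W)) = (\<integral>\<omega>. f \<omega> \<partial>W)"
  using integral_distr[OF measurable_splice assms, of i] by (simp add: distr_splice)

lemma Lp_fun_splice:
  assumes "f \<in> Lp_fun W p"
  shows "(\<lambda>z. f (splice i (fst z) (snd z))) \<in> Lp_fun (W \<Otimes>\<^sub>M W) p"
proof -
  note [measurable] = Lp_funD(1)[OF assms]
  show ?thesis
    using integrable_splice[OF Lp_funD(2)[OF assms], of i] by (simp add: Lp_fun_def)
qed

lemma AE_integrable_splice:
  assumes "integrable W f"
  shows "AE \<omega> in W. integrable W (\<lambda>\<omega>'. f (splice i \<omega> \<omega>') :: real)"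
  using WW.AE_integrable_fst'[OF integrable_splice[OF assms, of i]] by simp

lemma integrable_avg:
  assumes "integrable W f"
  shows "integrable W (avg i f)"
  using WW.integrable_fst'[OF integrable_splice[OF assms, of i]] by (simp add: avg_def[abs_def])

lemma integral_avg:
  assumes "integrable W f"
  shows "(\<integral>\<omega>. avg i f \<omega> \<partial>W) = (\<integral>\<omega>. f \<omega> \<partial>W)"
  using WW.integral_fst'[OF integrable_splice[OF assms, of i]] integral_splice[of f i] assms
  by (simp add: avg_def[abs_def])

lemma avg_add_AE:
  assumes "integrable W f" "integrable W g"
  shows "AE \<omega> in W. avg i (\<lambda>\<omega>. f \<omega> + g \<omega>) \<omega> = avg i f \<omega> + avg i g \<omega>"
  using AE_integrable_splice[OF assms(1), of i] AE_integrable_splice[OF assms(2), of i]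
  by eventually_elim (simp add: avg_def)

lemma Lp_fun_avg:
  assumes "f \<in> Lp_fun W p" "1 \<le> p"
  shows "avg i f \<in> Lp_fun W p"
    and "(\<integral>\<omega>. \<bar>avg i f \<omega>\<bar> ^ p \<partial>W) \<le> (\<integral>\<omega>. \<bar>f \<omega>\<bar> ^ p \<partial>W)"
proof -
  note [measurable] = Lp_funD(1)[OF assms(1)]
  have "avg i f = (\<lambda>\<omega>. \<integral>\<omega>'. f (splice i (fst (\<omega>, \<omega>')) (snd (\<omega>, \<omega>'))) \<partial>W)"
    by (simp add: avg_def[abs_def])
  then show "avg i f \<in> Lp_fun W p"
    and "(\<integral>\<omega>. \<bar>avg i f \<omega>\<bar> ^ p \<partial>W) \<le> (\<integral>\<omega>. \<bar>f \<omega>\<bar> ^ p \<partial>W)"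
    using WW.Lp_fun_integral_fst[OF Lp_fun_splice[OF assms(1), of i] assms(2)]
      integral_splice[of "\<lambda>\<omega>. \<bar>f \<omega>\<bar> ^ p" i] by auto
qed

text \<open>The pull-out property of conditional expectations: \<open>G\<close> is unaffected when
  the past before \<open>i\<close> is resampled, so it can be moved into the inner integral. This is
  valid pointwise, including where that integral has its default value.\<close>

lemma integral_avg_mult:
  assumes "integrable W (\<lambda>\<omega>. f \<omega> * G \<omega>)" and G: "\<And>\<omega> \<omega>'. G (splice i \<omega> \<omega>') = G \<omega>"
  shows "(\<integral>\<omega>. avg i f \<omega> * G \<omega> \<partial>W) = (\<integral>\<omega>. f \<omega> * G \<omega> \<partial>W)"
proof -
  have "avg i f \<omega> * G \<omega> = avg i (\<lambda>\<omega>. f \<omega> * G \<omega>) \<omega>" for \<omega>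
    by (simp add: avg_def G)
  then show ?thesis using integral_avg[OF assms(1), of i] by simp
qed

text \<open>\<open>F\<close> sees only the resampled coordinates, so its average is the constant
  \<open>\<integral>\<omega>. F \<omega> \<partial>W\<close>, and the pull-out property gives the
  product.\<close>

lemma integral_mult_indep:
  fixes F G :: "(int \<Rightarrow> 'e) \<Rightarrow> real"
  assumes "integrable W (\<lambda>\<omega>. F \<omega> * G \<omega>)"
    and G: "\<And>\<omega> \<omega>'. G (splice i \<omega> \<omega>') = G \<omega>" and F: "\<And>\<omega> \<omega>'. F (splice i \<omega> \<omega>') = F \<omega>'"
  shows "(\<integral>\<omega>. F \<omega> * G \<omega> \<partial>W) = (\<integral>\<omega>. F \<omega> \<partial>W) * (\<integral>\<omega>. G \<omega> \<partial>W)"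
proof -
  have "avg i F \<omega> = (\<integral>\<omega>. F \<omega> \<partial>W)" for \<omega> by (simp add: avg_def F)
  then show ?thesis using integral_avg_mult[OF assms(1,2)] by simp
qed

subsection \<open>Convergence of the averages\<close>

text \<open>The L^1 distance suits the approximation from cylinder sets upward. The passage to L^p
  is made at the end by truncation.\<close>

definition avg_error :: "int \<Rightarrow> ((int \<Rightarrow> 'e) \<Rightarrow> real) \<Rightarrow> real" where
  "avg_error i f = (\<integral>\<omega>. \<bar>avg i f \<omega> - f \<omega>\<bar> \<partial>W)"

lemma avg_error_add_le:
  assumes "integrable W f" "integrable W g"
  shows "avg_error i (\<lambda>\<omega>. f \<omega> + g \<omega>) \<le> avg_error i f + avg_error i g"
proof -
  note int [simp] = assms integrable_avg[OF assms(1), of i] integrable_avg[OF assms(2), of i]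
  have int_add [simp]: "integrable W (avg i (\<lambda>\<omega>. f \<omega> + g \<omega>))"
    by (intro integrable_avg Bochner_Integration.integrable_add assms)
  have "avg_error i (\<lambda>\<omega>. f \<omega> + g \<omega>) \<le> (\<integral>\<omega>. \<bar>avg i f \<omega> - f \<omega>\<bar> + \<bar>avg i g \<omega> - g \<omega>\<bar> \<partial>W)"
    unfolding avg_error_def
    by (rule integral_mono_AE) (use avg_add_AE[OF assms, of i] in \<open>auto elim!: eventually_mono\<close>)
  also have "\<dots> = avg_error i f + avg_error i g"
    unfolding avg_error_def by (rule Bochner_Integration.integral_add) auto
  finally show ?thesis .
qed

lemma avg_error_le:
  assumes "integrable W f"
  shows "avg_error i f \<le> 2 * (\<integral>\<omega>. \<bar>f \<omega>\<bar> \<partial>W)"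
proof -
  note int = assms integrable_avg[OF assms(1), of i]
  have L1: "f \<in> Lp_fun W 1" using assms by (simp add: Lp_fun_def)
  have "avg_error i f \<le> (\<integral>\<omega>. \<bar>avg i f \<omega>\<bar> + \<bar>f \<omega>\<bar> \<partial>W)"
    unfolding avg_error_def by (rule integral_mono) (use int in auto)
  also have "\<dots> = (\<integral>\<omega>. \<bar>avg i f \<omega>\<bar> \<partial>W) + (\<integral>\<omega>. \<bar>f \<omega>\<bar> \<partial>W)"
    by (rule Bochner_Integration.integral_add) (use int in auto)
  also have "\<dots> \<le> 2 * (\<integral>\<omega>. \<bar>f \<omega>\<bar> \<partial>W)"
    using Lp_fun_avg(2)[OF L1, of i] by simp
  finally show ?thesis .
qed

lemma avg_error_nonneg: "0 \<le> avg_error i f"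
  by (simp add: avg_error_def)

text \<open>Dominated convergence makes \<open>s k\<close> close to \<open>f\<close> in L^1, and by
  \<open>avg_error_le\<close> the error of \<open>f - s k\<close> is then small uniformly in
  \<open>n\<close>. So the good functions are closed under dominated pointwise limits.\<close>

lemma avg_error_tendsto_limit:
  assumes f: "integrable W f" and s: "\<And>k. integrable W (s k)"
    and lim: "\<And>\<omega>. \<omega> \<in> space W \<Longrightarrow> (\<lambda>k. s k \<omega>) \<longlonglongrightarrow> f \<omega>"
    and w: "integrable W w" "\<And>k \<omega>. \<omega> \<in> space W \<Longrightarrow> \<bar>s k \<omega>\<bar> \<le> w \<omega>"
    and conv: "\<And>k. (\<lambda>n. avg_error (t - int n) (s k)) \<longlonglongrightarrow> 0"
  shows "(\<lambda>n. avg_error (t - int n) f) \<longlonglongrightarrow> 0"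
proof -
  have L1: "(\<lambda>k. \<integral>\<omega>. \<bar>f \<omega> - s k \<omega>\<bar> \<partial>W) \<longlonglongrightarrow> (\<integral>\<omega>. 0 \<partial>W)"
  proof (rule integral_dominated_convergence[where w = "\<lambda>\<omega>. \<bar>f \<omega>\<bar> + w \<omega>"])
    show "AE \<omega> in W. (\<lambda>k. \<bar>f \<omega> - s k \<omega>\<bar>) \<longlonglongrightarrow> 0"
      using lim by (intro AE_I2) (auto intro!: tendsto_eq_intros)
    show "AE \<omega> in W. norm \<bar>f \<omega> - s k \<omega>\<bar> \<le> \<bar>f \<omega>\<bar> + w \<omega>" for k
      using w(2)[of _ k] by (intro AE_I2) (smt (verit) real_norm_def)
  qed (use f s w in auto)
  show ?thesis
  proof (rule LIMSEQ_I)
    fix e :: real assume e: "e > 0"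
    \<comment> \<open>The factor 2 in \<open>avg_error_le\<close> turns \<open>e / 4\<close> into
      \<open>e / 2\<close>.\<close>
    have "eventually (\<lambda>k. (\<integral>\<omega>. \<bar>f \<omega> - s k \<omega>\<bar> \<partial>W) < e / 4) sequentially"
      using order_tendstoD(2)[OF L1, of "e / 4"] e by simp
    then obtain k where k: "(\<integral>\<omega>. \<bar>f \<omega> - s k \<omega>\<bar> \<partial>W) < e / 4"
      by (auto simp: eventually_sequentially)
    obtain n0 where n0: "\<And>n. n \<ge> n0 \<Longrightarrow> avg_error (t - int n) (s k) < e / 2"
      using order_tendstoD(2)[OF conv[of k], of "e / 2"] e by (auto simp: eventually_sequentially)
    have "norm (avg_error (t - int n) f - 0) < e" if "n \<ge> n0" for n
    proof -
      have int: "integrable W (\<lambda>\<omega>. f \<omega> - s k \<omega>)" using f s by auto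
      have "avg_error (t - int n) f \<le> avg_error (t - int n) (s k) + avg_error (t - int n) (\<lambda>\<omega>. f \<omega> - s k \<omega>)"
        using avg_error_add_le[OF s[of k] int, of "t - int n"] by simp
      also have "\<dots> < e" using n0[OF that] avg_error_le[OF int, of "t - int n"] k by simp
      finally show ?thesis using avg_error_nonneg[of "t - int n" f] by simp
    qed
    then show "\<exists>no. \<forall>n\<ge>no. norm (avg_error (t - int n) f - 0) < e" by blast
  qed
qed

lemma avg_error_tendsto_add:
  assumes "integrable W f" "integrable W g"
    and "(\<lambda>n. avg_error (t - int n) f) \<longlonglongrightarrow> 0" "(\<lambda>n. avg_error (t - int n) g) \<longlonglongrightarrow> 0"
  shows "(\<lambda>n. avg_error (t - int n) (\<lambda>\<omega>. f \<omega> + g \<omega>)) \<longlonglongrightarrow> 0"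
  by (rule tendsto_sandwich[OF _ _ tendsto_const tendsto_add_zero[OF assms(3,4)]])
     (use avg_error_add_le[OF assms(1,2)] avg_error_nonneg in auto)

lemma avg_error_scale: "avg_error i (\<lambda>\<omega>. f \<omega> * c) = avg_error i f * \<bar>c\<bar>"
proof -
  have "avg i (\<lambda>\<omega>. f \<omega> * c) \<omega> = avg i f \<omega> * c" for \<omega>
    by (simp add: avg_def)
  then have "\<bar>avg i (\<lambda>\<omega>. f \<omega> * c) \<omega> - f \<omega> * c\<bar> = \<bar>avg i f \<omega> - f \<omega>\<bar> * \<bar>c\<bar>" for \<omega>
    by (simp add: abs_mult[symmetric] left_diff_distrib)
  then show ?thesis by (simp add: avg_error_def)
qed

lemma avg_error_cong:
  assumes "\<And>\<omega>. \<omega> \<in> space W \<Longrightarrow> f \<omega> = g \<omega>"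
  shows "avg_error i f = avg_error i g"
  unfolding avg_error_def avg_def
  using assms splice_in_space by (intro Bochner_Integration.integral_cong refl) (simp cong: Bochner_Integration.integral_cong)

text \<open>Dynkin induction starting from cylinders. A cylinder restricts finitely many
  coordinates, and once \<open>t - n\<close> lies at or below all of them averaging does not change
  its indicator.\<close>

lemma avg_error_indicator_tendsto:
  assumes "A \<in> sets W"
  shows "(\<lambda>n. avg_error (t - int n) (indicator A)) \<longlonglongrightarrow> 0"
proof -
  have A: "A \<in> sigma_sets (\<Pi>\<^sub>E i\<in>(UNIV :: int set). space \<mu>) (prod_algebra UNIV (\<lambda>_. \<mu>))"
    using assms by (simp add: sets_PiM)
  show ?thesis
    using Int_stable_prod_algebra prod_algebra_sets_into_space A
  proof (induction rule: sigma_sets_induct_disjoint)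
    case (basic A)
    then obtain J F where A: "A = prod_emb UNIV (\<lambda>_. \<mu>) J (Pi\<^sub>E J F)" "finite J"
      by (rule prod_algebraE)
    \<comment> \<open>Inserting \<open>t\<close> keeps the set nonempty when \<open>J\<close> is
      empty.\<close>
    define n0 where "n0 = nat (t - Min (insert t J))"
    have "avg_error (t - int n) (indicator A) = 0" if "n \<ge> n0" for n
    proof -
      have le: "t - int n \<le> j" if "j \<in> J" for j
      proof -
        have "Min (insert t J) \<le> j" using A(2) that by auto
        moreover have "t - int n \<le> Min (insert t J)" using \<open>n \<ge> n0\<close> unfolding n0_def by linarith
        ultimately show ?thesis by simp
      qed
      have "indicator A (splice (t - int n) \<omega> \<omega>') = (indicator A \<omega> :: real)"
        if "\<omega> \<in> space W" "\<omega>' \<in> space W" for \<omega> \<omega>'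
      proof -
        have "splice (t - int n) \<omega> \<omega>' \<in> space W" using that by (rule splice_in_space)
        then have "splice (t - int n) \<omega> \<omega>' \<in> A \<longleftrightarrow> \<omega> \<in> A"
          using that le by (auto simp: A(1) prod_emb_def splice_def space_PiM PiE_iff)
        then show ?thesis by (simp add: indicator_def)
      qed
      then have "avg (t - int n) (indicator A) \<omega> = indicator A \<omega>" if "\<omega> \<in> space W" for \<omega>
        using that by (simp add: avg_def W.P.prob_space cong: Bochner_Integration.integral_cong)
      then show ?thesis
        unfolding avg_error_def by (simp cong: Bochner_Integration.integral_cong)
    qed
    then show ?case
      by (intro tendsto_eventually) (auto simp: eventually_sequentially)
  next
    case empty
    then show ?case by (simp add: avg_error_def avg_def)
  next
    case (compl A)
    have Aw: "A \<in> sets W" using compl by (simp add: sets_PiM)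
    \<comment> \<open>The indicator of the complement is written as a sum with a scaled indicator,
      to which \<open>avg_error_tendsto_add\<close> and \<open>avg_error_scale\<close>
      apply.\<close>
    have 1: "(\<lambda>n. avg_error (t - int n) (\<lambda>\<omega>. indicator A \<omega> * (-1))) \<longlonglongrightarrow> 0"
      using compl.IH by (simp only: avg_error_scale) simp
    have 2: "(\<lambda>n. avg_error (t - int n) (\<lambda>\<omega>. 1)) \<longlonglongrightarrow> 0"
      by (simp add: avg_error_def avg_def W.P.prob_space)
    have "(\<lambda>n. avg_error (t - int n) (\<lambda>\<omega>. 1 + indicator A \<omega> * (-1))) \<longlonglongrightarrow> 0"
      using Aw 1 2 by (intro avg_error_tendsto_add) (auto simp: W.P.emeasure_eq_measure)
    moreover have "avg_error i (\<lambda>\<omega>. 1 + indicator A \<omega> * (-1)) =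
        avg_error i (indicator ((\<Pi>\<^sub>E i\<in>(UNIV :: int set). space \<mu>) - A))" for i
      by (rule avg_error_cong) (auto simp: space_PiM indicator_def)
    ultimately show ?case by simp
  next
    case (union A)
    have Aw: "A i \<in> sets W" for i using union by (auto simp: sets_PiM)
    have ind: "(\<Sum>j<k. indicator (A j) \<omega>) = (indicator (\<Union>j<k. A j) \<omega> :: real)" for k \<omega>
      using union.hyps by (subst indicator_UN_disjoint) (auto simp: disjoint_family_on_def)
    show ?case
    proof (rule avg_error_tendsto_limit[where w = "\<lambda>_. 1" and s = "\<lambda>k \<omega>. \<Sum>j<k. indicator (A j) \<omega>"])
      show "integrable W (indicator (\<Union>i. A i) :: _ \<Rightarrow> real)"
        using Aw by (auto simp: W.P.emeasure_eq_measure)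
      show "integrable W (\<lambda>\<omega>. \<Sum>j<k. indicator (A j) \<omega> :: real)" for k
        using Aw by (auto simp: W.P.emeasure_eq_measure)
      show "(\<lambda>k. \<Sum>j<k. indicator (A j) \<omega>) \<longlonglongrightarrow> (indicator (\<Union>i. A i) \<omega> :: real)" for \<omega>
        unfolding ind by (rule LIMSEQ_indicator_UN)
      show "\<bar>\<Sum>j<k. indicator (A j) \<omega>\<bar> \<le> (1 :: real)" for k \<omega>
        unfolding ind by (simp add: indicator_def)
      show "(\<lambda>n. avg_error (t - int n) (\<lambda>\<omega>. \<Sum>j<k. indicator (A j) \<omega>)) \<longlonglongrightarrow> 0" for k
      proof (induction k)
        case 0
        show ?case by (simp add: avg_error_def avg_def)
      next
        case (Suc k)
        show ?case unfolding sum.lessThan_Suc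
          using Aw Suc union.IH by (intro avg_error_tendsto_add) (auto simp: W.P.emeasure_eq_measure)
      qed
    qed simp
  qed
qed

text \<open>Martingale convergence in L^1 as the remembered stretch of time reaches further back, by
  the standard induction from indicators to integrable functions.\<close>

lemma avg_error_tendsto:
  assumes "integrable W f"
  shows "(\<lambda>n. avg_error (t - int n) f) \<longlonglongrightarrow> 0"
  using assms
proof (induction rule: integrable_induct)
  case (base A c)
  show ?case
    using tendsto_mult_left_zero[OF avg_error_indicator_tendsto[OF base(1), of t], of "\<bar>c\<bar>"]
    by (simp add: avg_error_scale)
next
  case (add f g)
  then show ?case by (intro avg_error_tendsto_add)
next
  case (lim f s)
  show ?case
  proof (rule avg_error_tendsto_limit[where w = "\<lambda>\<omega>. 2 * norm (f \<omega>)" and s = s])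
    show "\<bar>s k \<omega>\<bar> \<le> 2 * norm (f \<omega>)" if "\<omega> \<in> space W" for k \<omega>
      using lim that by (metis real_norm_def)
    show "integrable W (\<lambda>\<omega>. 2 * norm (f \<omega>))"
      by (intro integrable_mult_right integrable_norm lim)
  qed (use lim in blast)+
qed

text \<open>\<open>f\<close> is cut at level \<open>K\<close> into a bounded part \<open>h K\<close>
  and a remainder \<open>r K\<close>. The remainder is small in L^p by dominated convergence and
  averaging does not enlarge it. For the bounded part the error is at most \<open>2 * K\<close>, so
  its p-th power is at most \<open>(2 * K) ^ (p - 1)\<close> times the error, and L^1 convergence
  suffices. First \<open>K\<close> is chosen, then \<open>n\<close>.\<close>

lemma avg_tendsto_Lp:
  assumes f: "f \<in> Lp_fun W p" and p: "1 \<le> p"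
  shows "(\<lambda>n. \<integral>\<omega>. \<bar>avg (t - int n) f \<omega> - f \<omega>\<bar> ^ p \<partial>W) \<longlonglongrightarrow> 0"
proof -
  note [measurable] = Lp_funD(1)[OF f]
  define h where "h K \<omega> = max (- real K) (min (real K) (f \<omega>))" for K \<omega>
  define r where "r K \<omega> = f \<omega> - h K \<omega>" for K \<omega>
  have h_le: "\<bar>h K \<omega>\<bar> \<le> real K" "\<bar>h K \<omega>\<bar> \<le> \<bar>f \<omega>\<bar>" and r_le: "\<bar>r K \<omega>\<bar> \<le> \<bar>f \<omega>\<bar>" for K \<omega>
    by (auto simp: h_def r_def)
  have h_meas [measurable]: "h K \<in> borel_measurable W" and r_meas [measurable]: "r K \<in> borel_measurable W" for K
    unfolding h_def[abs_def] r_def[abs_def] by measurable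
  have dom: "u \<in> Lp_fun W p" if [measurable]: "u \<in> borel_measurable W" and "\<And>\<omega>. \<bar>u \<omega>\<bar> \<le> \<bar>f \<omega>\<bar>" for u
  proof -
    have "integrable W (\<lambda>\<omega>. \<bar>u \<omega>\<bar> ^ p)"
      by (rule Bochner_Integration.integrable_bound[OF Lp_funD(2)[OF f]])
         (use that in \<open>auto intro!: AE_I2 power_mono\<close>)
    then show ?thesis by (simp add: Lp_fun_def)
  qed
  have hL: "h K \<in> Lp_fun W p" and rL: "r K \<in> Lp_fun W p" for K
    using h_le r_le by (auto intro: dom)
  have "(\<lambda>K. \<integral>\<omega>. \<bar>r K \<omega>\<bar> ^ p \<partial>W) \<longlonglongrightarrow> (\<integral>\<omega>. 0 \<partial>W)"
  proof (rule integral_dominated_convergence[where w = "\<lambda>\<omega>. \<bar>f \<omega>\<bar> ^ p"])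
    show "AE \<omega> in W. (\<lambda>K. \<bar>r K \<omega>\<bar> ^ p) \<longlonglongrightarrow> 0"
    proof (rule AE_I2)
      fix \<omega>
      obtain K0 where K0: "\<bar>f \<omega>\<bar> \<le> real K0" using real_arch_simple by blast
      have "\<bar>r K \<omega>\<bar> ^ p = 0" if "K \<ge> K0" for K
        using K0 that p by (auto simp: r_def h_def max_def min_def)
      then show "(\<lambda>K. \<bar>r K \<omega>\<bar> ^ p) \<longlonglongrightarrow> 0"
        by (intro tendsto_eventually) (auto simp: eventually_sequentially)
    qed
    show "AE \<omega> in W. norm (\<bar>r K \<omega>\<bar> ^ p) \<le> \<bar>f \<omega>\<bar> ^ p" for K
      using r_le by (auto intro!: AE_I2 power_mono)
  qed (use Lp_funD(2)[OF f] in auto)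
  then have r_lim: "(\<lambda>K. \<integral>\<omega>. \<bar>r K \<omega>\<bar> ^ p \<partial>W) \<longlonglongrightarrow> 0" by simp
  define B where "B = (2 :: real) ^ p"
  have B: "B > 0" by (simp add: B_def)
  have main: "(\<integral>\<omega>. \<bar>avg i f \<omega> - f \<omega>\<bar> ^ p \<partial>W) \<le>
      B * (2 * real K) ^ (p - 1) * avg_error i (h K) + 2 * B * B * (\<integral>\<omega>. \<bar>r K \<omega>\<bar> ^ p \<partial>W)" for i K
  proof -
    note L = Lp_fun_avg[OF f p, of i] Lp_fun_avg[OF hL p, of i K] Lp_fun_avg[OF rL p, of i K]
    have i1: "integrable W (\<lambda>\<omega>. \<bar>avg i f \<omega> - f \<omega>\<bar> ^ p)"
      by (rule Lp_funD(2)[OF Lp_fun_diff[OF L(1) f]])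
    have hI: "integrable W (h K)" and rI: "integrable W (r K)"
      using W.integrable_Lp[OF hL p] W.integrable_Lp[OF rL p] by auto
    have i2: "integrable W (\<lambda>\<omega>. \<bar>avg i (h K) \<omega> - h K \<omega>\<bar>)"
      using hI integrable_avg[OF hI, of i] by auto
    have i3: "integrable W (\<lambda>\<omega>. \<bar>avg i (r K) \<omega>\<bar> ^ p)" "integrable W (\<lambda>\<omega>. \<bar>r K \<omega>\<bar> ^ p)"
      using Lp_funD(2)[OF L(5)] Lp_funD(2)[OF rL] by auto
    \<comment> \<open>The bound is needed at every point; where the inner integral does not exist,
      \<open>avg\<close> is 0.\<close>
    have avg_h: "\<bar>avg i (h K) \<omega>\<bar> \<le> real K" for \<omega>
    proof (cases "integrable W (\<lambda>\<omega>'. h K (splice i \<omega> \<omega>'))")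
      case True
      have "\<bar>avg i (h K) \<omega>\<bar> \<le> (\<integral>\<omega>'. \<bar>h K (splice i \<omega> \<omega>')\<bar> \<partial>W)"
        unfolding avg_def by (rule integral_abs_bound)
      also have "\<dots> \<le> (\<integral>\<omega>'. real K \<partial>W)"
        by (rule integral_mono) (use True h_le in auto)
      finally show ?thesis by (simp add: W.P.prob_space)
    qed (simp add: avg_def not_integrable_integral_eq)
    have "(\<integral>\<omega>. \<bar>avg i f \<omega> - f \<omega>\<bar> ^ p \<partial>W) \<le>
       (\<integral>\<omega>. B * ((2 * real K) ^ (p - 1) * \<bar>avg i (h K) \<omega> - h K \<omega>\<bar>) + B * (B * (\<bar>avg i (r K) \<omega>\<bar> ^ p + \<bar>r K \<omega>\<bar> ^ p)) \<partial>W)"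
    proof (rule integral_mono_AE[OF i1])
      show "integrable W (\<lambda>\<omega>. B * ((2 * real K) ^ (p - 1) * \<bar>avg i (h K) \<omega> - h K \<omega>\<bar>) +
           B * (B * (\<bar>avg i (r K) \<omega>\<bar> ^ p + \<bar>r K \<omega>\<bar> ^ p)))"
        using i2 i3 by auto
      have "f = (\<lambda>\<omega>. h K \<omega> + r K \<omega>)" by (simp add: r_def fun_eq_iff)
      then have "AE \<omega> in W. avg i f \<omega> = avg i (h K) \<omega> + avg i (r K) \<omega>"
        using avg_add_AE[OF hI rI, of i] by simp
      then show "AE \<omega> in W. \<bar>avg i f \<omega> - f \<omega>\<bar> ^ p \<le>
          B * ((2 * real K) ^ (p - 1) * \<bar>avg i (h K) \<omega> - h K \<omega>\<bar>) + B * (B * (\<bar>avg i (r K) \<omega>\<bar> ^ p + \<bar>r K \<omega>\<bar> ^ p))"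
      proof eventually_elim
        case (elim \<omega>)
        define u where "u = avg i (h K) \<omega> - h K \<omega>"
        define v where "v = avg i (r K) \<omega> - r K \<omega>"
        have "avg i f \<omega> - f \<omega> = u + v" using elim by (simp add: u_def v_def r_def)
        then have 1: "\<bar>avg i f \<omega> - f \<omega>\<bar> ^ p \<le> B * (\<bar>u\<bar> ^ p + \<bar>v\<bar> ^ p)"
          using abs_add_power_le[of u v p] by (simp add: B_def)
        have 2: "\<bar>v\<bar> ^ p \<le> B * (\<bar>avg i (r K) \<omega>\<bar> ^ p + \<bar>r K \<omega>\<bar> ^ p)"
          using abs_add_power_le[of "avg i (r K) \<omega>" "- r K \<omega>" p] by (simp add: B_def v_def)
        have "\<bar>u\<bar> \<le> 2 * real K" using avg_h[of \<omega>] h_le(1)[of K \<omega>] unfolding u_def by linarith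
        then have "\<bar>u\<bar> ^ (p - 1) * \<bar>u\<bar> \<le> (2 * real K) ^ (p - 1) * \<bar>u\<bar>"
          by (intro mult_right_mono power_mono) auto
        then have 3: "\<bar>u\<bar> ^ p \<le> (2 * real K) ^ (p - 1) * \<bar>u\<bar>"
          using p power_Suc2[of "\<bar>u\<bar>" "p - 1"] by simp
        have "B * (\<bar>u\<bar> ^ p + \<bar>v\<bar> ^ p) \<le>
            B * ((2 * real K) ^ (p - 1) * \<bar>u\<bar> + B * (\<bar>avg i (r K) \<omega>\<bar> ^ p + \<bar>r K \<omega>\<bar> ^ p))"
          using B 2 3 by (intro mult_left_mono add_mono) auto
        then show ?case using 1 unfolding u_def by (simp add: distrib_left)
      qed
    qed
    also have "\<dots> = B * ((2 * real K) ^ (p - 1) * avg_error i (h K)) +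
        B * (B * ((\<integral>\<omega>. \<bar>avg i (r K) \<omega>\<bar> ^ p \<partial>W) + (\<integral>\<omega>. \<bar>r K \<omega>\<bar> ^ p \<partial>W)))"
      using i2 i3 by (simp add: avg_error_def)
    also have "\<dots> \<le> B * ((2 * real K) ^ (p - 1) * avg_error i (h K)) +
        B * (B * ((\<integral>\<omega>. \<bar>r K \<omega>\<bar> ^ p \<partial>W) + (\<integral>\<omega>. \<bar>r K \<omega>\<bar> ^ p \<partial>W)))"
      using B L(6) by (intro add_mono mult_left_mono) auto
    finally show ?thesis by (simp add: algebra_simps)
  qed
  show ?thesis
  proof (rule LIMSEQ_I)
    fix e :: real assume e: "e > 0"
    have "(\<lambda>K. 2 * B * B * (\<integral>\<omega>. \<bar>r K \<omega>\<bar> ^ p \<partial>W)) \<longlonglongrightarrow> 0"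
      by (rule tendsto_mult_right_zero[OF r_lim])
    then obtain K where K: "2 * B * B * (\<integral>\<omega>. \<bar>r K \<omega>\<bar> ^ p \<partial>W) < e / 2"
      using order_tendstoD(2)[of _ 0 sequentially "e / 2"] e
      by (metis (lifting) eventually_sequentially half_gt_zero order_refl)
    have "(\<lambda>n. B * (2 * real K) ^ (p - 1) * avg_error (t - int n) (h K)) \<longlonglongrightarrow> 0"
      by (intro tendsto_mult_right_zero avg_error_tendsto W.integrable_Lp[OF hL p])
    then obtain n0 where n0: "\<And>n. n \<ge> n0 \<Longrightarrow> B * (2 * real K) ^ (p - 1) * avg_error (t - int n) (h K) < e / 2"
      using order_tendstoD(2)[of _ 0 sequentially "e / 2"] e
      by (metis (lifting) eventually_sequentially half_gt_zero)
    have "norm ((\<integral>\<omega>. \<bar>avg (t - int n) f \<omega> - f \<omega>\<bar> ^ p \<partial>W) - 0) < e" if "n \<ge> n0" for n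
      using main[of "t - int n" K] n0[OF that] K by simp
    then show "\<exists>no. \<forall>n\<ge>no. norm ((\<integral>\<omega>. \<bar>avg (t - int n) f \<omega> - f \<omega>\<bar> ^ p \<partial>W) - 0) < e"
      by blast
  qed
qed

end

subsection \<open>Backward innovations\<close>

text \<open>Exact dependence on coordinates in place of measurability with respect to a
  sub-sigma-algebra: with it, \<open>splice\<close> leaves such functions unchanged at every
  point.\<close>

definition depends_on :: "'i set \<Rightarrow> (('i \<Rightarrow> 'e) \<Rightarrow> 'b) \<Rightarrow> bool" where
  "depends_on S f \<longleftrightarrow> (\<forall>\<omega> \<omega>'. (\<forall>s\<in>S. \<omega> s = \<omega>' s) \<longrightarrow> f \<omega> = f \<omega>')"

lemma depends_onD: "depends_on S f \<Longrightarrow> (\<And>s. s \<in> S \<Longrightarrow> \<omega> s = \<omega>' s) \<Longrightarrow> f \<omega> = f \<omega>'"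
  by (auto simp: depends_on_def)

lemma depends_on_mono: "depends_on S f \<Longrightarrow> S \<subseteq> T \<Longrightarrow> depends_on T f"
  unfolding depends_on_def by blast

lemma depends_on_prod:
  fixes Y :: "'j \<Rightarrow> ('i \<Rightarrow> 'e) \<Rightarrow> 'b :: comm_monoid_mult"
  assumes "\<And>j. j \<in> C \<Longrightarrow> depends_on S (Y j)"
  shows "depends_on S (\<lambda>\<omega>. \<Prod>j\<in>C. Y j \<omega>)"
  unfolding depends_on_def
proof (intro allI impI prod.cong refl)
  fix \<omega> \<omega>' :: "'i \<Rightarrow> 'e" and j assume "\<forall>s\<in>S. \<omega> s = \<omega>' s" "j \<in> C"
  then show "Y j \<omega> = Y j \<omega>'" using depends_onD[OF assms] by blast
qed

context iid_space
begin

lemma depends_on_avg: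
  assumes "depends_on S f"
  shows "depends_on (S \<inter> {i..}) (avg i f)"
  unfolding depends_on_def
proof (intro allI impI)
  fix \<omega> \<omega>' :: "int \<Rightarrow> 'e" assume "\<forall>s\<in>S \<inter> {i..}. \<omega> s = \<omega>' s"
  then have "f (splice i \<omega> \<eta>) = f (splice i \<omega>' \<eta>)" for \<eta>
    by (intro depends_onD[OF assms]) (auto simp: splice_def)
  then show "avg i f \<omega> = avg i f \<omega>'" by (simp add: avg_def)
qed

lemma splice_future: "depends_on S f \<Longrightarrow> S \<subseteq> {i..} \<Longrightarrow> f (splice i \<omega> \<omega>') = f \<omega>"
  by (rule depends_onD) (auto simp: splice_def)

lemma splice_past: "depends_on S f \<Longrightarrow> S \<subseteq> {..<i} \<Longrightarrow> f (splice i \<omega> \<omega>') = f \<omega>'"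
  by (rule depends_onD) (auto simp: splice_def)

definition proc :: "((nat \<Rightarrow> 'e) \<Rightarrow> real) \<Rightarrow> int \<Rightarrow> (int \<Rightarrow> 'e) \<Rightarrow> real" where
  "proc g t \<omega> = g (\<lambda>j. \<omega> (t - int j))"

definition innov :: "((nat \<Rightarrow> 'e) \<Rightarrow> real) \<Rightarrow> nat \<Rightarrow> int \<Rightarrow> (int \<Rightarrow> 'e) \<Rightarrow> real" where
  "innov g m t \<omega> = avg (t - int m) (proc g t) \<omega> - avg (t - int m + 1) (proc g t) \<omega>"

lemma depends_on_proc: "depends_on {..t} (proc g t)"
  unfolding depends_on_def proc_def by (intro allI impI arg_cong[where f = g]) auto

lemma depends_on_innov: "depends_on {t - int m..t} (innov g m t)"
proof -
  have 1: "depends_on {t - int m..t} (avg (t - int m) (proc g t))"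
    by (rule depends_on_mono[OF depends_on_avg[OF depends_on_proc]]) auto
  have 2: "depends_on {t - int m..t} (avg (t - int m + 1) (proc g t))"
    by (rule depends_on_mono[OF depends_on_avg[OF depends_on_proc]]) auto
  show ?thesis
    unfolding depends_on_def innov_def using depends_onD[OF 1] depends_onD[OF 2]
    by (metis (no_types, lifting))
qed

text \<open>The sum telescopes. Its last term \<open>avg (t + 1)\<close> resamples every coordinate
  that enters \<open>proc g t\<close>, so it is the mean.\<close>

lemma sum_innov: "(\<Sum>m\<le>N. innov g m t \<omega>) = avg (t - int N) (proc g t) \<omega> - (\<integral>\<omega>. proc g t \<omega> \<partial>W)"
proof (induction N)
  case 0
  have "proc g t (splice (t + 1) \<omega> \<omega>') = proc g t \<omega>'" for \<omega>'
    by (rule splice_past[OF depends_on_proc]) auto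
  then have "avg (t + 1) (proc g t) \<omega> = (\<integral>\<omega>. proc g t \<omega> \<partial>W)" by (simp add: avg_def)
  then show ?case by (simp add: innov_def)
next
  case (Suc N)
  have "t - int (Suc N) + 1 = t - int N" by simp
  then show ?case using Suc by (simp add: innov_def)
qed

lemma Lp_fun_innov:
  assumes "proc g t \<in> Lp_fun W p" "1 \<le> p"
  shows "innov g m t \<in> Lp_fun W p"
  unfolding innov_def[abs_def] by (intro Lp_fun_diff Lp_fun_avg(1) assms)

text \<open>The two averages in \<open>innov\<close> differ in whether the coordinate \<open>i = t - m\<close> comes from \<open>\<omega>\<close> or from
  the independent copy \<open>\<omega>'\<close>; this is the coupling in \<open>phys_dep\<close>, with time shifted by \<open>i\<close> and the
  coordinates before \<open>i\<close> taken from \<open>\<omega>'\<close>.\<close>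

lemma innov_power_le:
  assumes L: "proc g t \<in> Lp_fun W p" and p: "1 \<le> p"
    and [measurable]: "g \<in> borel_measurable (PiM UNIV (\<lambda>_. \<mu>))"
  shows "(\<integral>\<omega>. \<bar>innov g m t \<omega>\<bar> ^ p \<partial>W) \<le> phys_dep \<mu> g p m ^ p"
proof -
  define i where "i = t - int m"
  define h where "h z = proc g t (splice i (fst z) (snd z)) - proc g t (splice (i + 1) (fst z) (snd z))" for z
  have int: "integrable W (proc g t)" using W.P.integrable_Lp[OF L p] .
  have h: "h \<in> Lp_fun (W \<Otimes>\<^sub>M W) p"
    unfolding h_def[abs_def] by (intro Lp_fun_diff Lp_fun_splice L)
  \<comment> \<open>The two inner integrals combine into one only where both exist.\<close>
  have "AE \<omega> in W. \<bar>innov g m t \<omega>\<bar> ^ p = \<bar>\<integral>\<omega>'. h (\<omega>, \<omega>') \<partial>W\<bar> ^ p"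
    using AE_integrable_splice[OF int, of i] AE_integrable_splice[OF int, of "i + 1"]
    by eventually_elim (simp add: innov_def avg_def h_def i_def)
  then have "(\<integral>\<omega>. \<bar>innov g m t \<omega>\<bar> ^ p \<partial>W) = (\<integral>\<omega>. \<bar>\<integral>\<omega>'. h (\<omega>, \<omega>') \<partial>W\<bar> ^ p \<partial>W)"
    using Lp_funD(1)[OF Lp_fun_innov[OF L p, of m]] Lp_funD(1)[OF WW.Lp_fun_integral_fst(1)[OF h p]]
    by (intro integral_cong_AE) auto
  also have "\<dots> \<le> (\<integral>z. \<bar>h z\<bar> ^ p \<partial>(W \<Otimes>\<^sub>M W))"
    by (rule WW.Lp_fun_integral_fst(2)[OF h p])
  also have "\<dots> = phys_dep \<mu> g p m ^ p"
  proof -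
    \<comment> \<open>Time is shifted so that \<open>Some 0\<close> is time \<open>i\<close>.
      Strictly negative times come from the second copy, the others from the first.
      \<open>None\<close> takes time \<open>i\<close> of the second copy, which no
      \<open>Some u\<close> occupies, so the map is injective.\<close>
    let ?\<phi> = "\<lambda>q. case q of None \<Rightarrow> (True, i) | Some u \<Rightarrow> (u < 0, u + i)"
    let ?S = "\<lambda>(\<omega>, \<omega>') s. if fst (?\<phi> s) then \<omega>' (snd (?\<phi> s)) else \<omega> (snd (?\<phi> s))"
    let ?O = "PiM (UNIV :: int option set) (\<lambda>_. \<mu>)"
    let ?k = "\<lambda>e :: int option \<Rightarrow> 'e. \<bar>g (\<lambda>j. e (Some (int m - int j)))
             - g (\<lambda>j. if j = m then e None else e (Some (int m - int j)))\<bar> ^ p"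
    have inj: "inj ?\<phi>" by (auto simp: inj_def split: option.splits)
    note S = distr_select[OF inj]
    have hk: "\<bar>h z\<bar> ^ p = ?k (?S z)" for z
    proof -
      have 1: "proc g t (splice i (fst z) (snd z)) = g (\<lambda>j. ?S z (Some (int m - int j)))"
        unfolding proc_def by (intro arg_cong[where f = g] ext) (auto simp: splice_def i_def case_prod_unfold algebra_simps)
      have 2: "proc g t (splice (i + 1) (fst z) (snd z)) =
          g (\<lambda>j. if j = m then ?S z None else ?S z (Some (int m - int j)))"
        unfolding proc_def by (intro arg_cong[where f = g] ext) (auto simp: splice_def i_def case_prod_unfold algebra_simps)
      show ?thesis unfolding h_def 1 2 ..
    qed
    have [measurable]: "?k \<in> borel_measurable ?O"
    proof -
      have a: "(\<lambda>e :: int option \<Rightarrow> 'e. (\<lambda>j. e (Some (int m - int j)))) \<in> measurable ?O (PiM UNIV (\<lambda>_. \<mu>))"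
        by (rule measurable_PiM_single') (auto simp: space_PiM PiE_iff)
      have b: "(\<lambda>e :: int option \<Rightarrow> 'e. (\<lambda>j. if j = m then e None else e (Some (int m - int j)))) \<in> measurable ?O (PiM UNIV (\<lambda>_. \<mu>))"
      proof (rule measurable_PiM_single')
        show "(\<lambda>e :: int option \<Rightarrow> 'e. if j = m then e None else e (Some (int m - int j))) \<in> measurable ?O \<mu>" for j
          by (cases "j = m") simp_all
      qed (auto simp: space_PiM PiE_iff)
      show ?thesis
        using measurable_compose[OF a assms(3)] measurable_compose[OF b assms(3)] by measurable
    qed
    have "(\<integral>z. \<bar>h z\<bar> ^ p \<partial>(W \<Otimes>\<^sub>M W)) = (\<integral>e. ?k e \<partial>distr (W \<Otimes>\<^sub>M W) ?O ?S)"
      unfolding hk by (rule integral_distr[OF S(1), symmetric]) measurable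
    also have "\<dots> = (\<integral>e. ?k e \<partial>?O)" unfolding S(2) ..
    also have "\<dots> = phys_dep \<mu> g p m ^ p"
    proof -
      have nn: "0 \<le> (\<integral>e. ?k e \<partial>?O)" by simp
      then have "((\<integral>e. ?k e \<partial>?O) powr (1 / real p)) ^ p = (\<integral>e. ?k e \<partial>?O)"
        using p by (cases "(\<integral>e. ?k e \<partial>?O) = 0") (auto simp: powr_power)
      then show ?thesis by (simp add: phys_dep_def)
    qed
    finally show ?thesis .
  qed
  finally show ?thesis .
qed

section \<open>Vanishing cumulants of innovations\<close>

text \<open>In a block containing \<open>j\<close> the other factors form a \<open>G\<close> that
  depends only on coordinates after \<open>i\<close>. Tested against such a \<open>G\<close>, the
  averages at \<open>i\<close> and at \<open>i + 1\<close> both integrate like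
  \<open>proc g (T j)\<close> itself, and their difference gives 0.\<close>

lemma cumulant_innov_unique_min:
  assumes I: "finite I" "card I \<le> p" "j \<in> I" and p: "1 \<le> p"
    and L: "\<And>t. proc g t \<in> Lp_fun W p"
    and min: "\<And>k. k \<in> I \<Longrightarrow> k \<noteq> j \<Longrightarrow> T j - int (m j) < T k - int (m k)"
  shows "cumulant W I (\<lambda>k. innov g (m k) (T k)) = 0"
  unfolding cumulant_eq_set_cumulant
proof (rule set_cumulant_eq_0_block[OF I(1,3)])
  fix C assume C: "C \<subseteq> I" "j \<in> C"
  have fin: "finite C" "card C \<le> p"
    using I C finite_subset card_mono[OF I(1) C(1)] by auto
  define i where "i = T j - int (m j)"
  define G where "G \<omega> = (\<Prod>k\<in>C - {j}. innov g (m k) (T k) \<omega>)" for \<omega>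
  have dep: "depends_on {i + 1..} G"
    unfolding G_def[abs_def]
  proof (rule depends_on_prod, rule depends_on_mono[OF depends_on_innov])
    fix k assume "k \<in> C - {j}"
    then have "T j - int (m j) < T k - int (m k)" using C by (intro min) auto
    then show "{T k - int (m k)..T k} \<subseteq> {i + 1..}" by (auto simp: i_def)
  qed
  have intG: "integrable W (\<lambda>\<omega>. f \<omega> * G \<omega>)" if "f \<in> Lp_fun W p" for f
  proof -
    let ?Y = "(\<lambda>k. innov g (m k) (T k))(j := f)"
    have "integrable W (\<lambda>\<omega>. \<Prod>k\<in>C. ?Y k \<omega>)"
      using that by (intro W.P.integrable_prod_Lp[OF fin]) (auto intro: Lp_fun_innov L p)
    moreover have "(\<Prod>k\<in>C. ?Y k \<omega>) = f \<omega> * G \<omega>" for \<omega>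
      unfolding G_def using C fin by (subst prod.remove[of _ j]) (auto intro!: prod.cong)
    ultimately show ?thesis by simp
  qed
  have "(\<integral>\<omega>. (\<Prod>k\<in>C. innov g (m k) (T k) \<omega>) \<partial>W) =
      (\<integral>\<omega>. avg i (proc g (T j)) \<omega> * G \<omega> - avg (i + 1) (proc g (T j)) \<omega> * G \<omega> \<partial>W)"
    using C fin by (intro Bochner_Integration.integral_cong refl)
      (simp add: prod.remove[of C j] G_def innov_def i_def left_diff_distrib)
  also have "\<dots> = (\<integral>\<omega>. avg i (proc g (T j)) \<omega> * G \<omega> \<partial>W) - (\<integral>\<omega>. avg (i + 1) (proc g (T j)) \<omega> * G \<omega> \<partial>W)"
    by (intro Bochner_Integration.integral_diff intG Lp_fun_avg(1) L p)
  also have "(\<integral>\<omega>. avg i (proc g (T j)) \<omega> * G \<omega> \<partial>W) = (\<integral>\<omega>. proc g (T j) \<omega> * G \<omega> \<partial>W)"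
    by (intro integral_avg_mult intG L splice_future[OF dep]) auto
  also have "(\<integral>\<omega>. avg (i + 1) (proc g (T j)) \<omega> * G \<omega> \<partial>W) = (\<integral>\<omega>. proc g (T j) \<omega> * G \<omega> \<partial>W)"
    by (intro integral_avg_mult intG L splice_future[OF dep]) auto
  finally show "(\<integral>\<omega>. (\<Prod>k\<in>C. innov g (m k) (T k) \<omega>) \<partial>W) = 0" by simp
qed

text \<open>Innovations ending before \<open>s\<close> and innovations starting at or after
  \<open>s\<close> use disjoint sets of coordinates, so all mixed moments factor. The indices
  \<open>a\<close> and \<open>b\<close> witness that both groups are nonempty.\<close>

lemma cumulant_innov_separated:
  assumes I: "finite I" "card I \<le> p" "a \<in> I" "b \<in> I" and p: "1 \<le> p"
    and L: "\<And>t. proc g t \<in> Lp_fun W p"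
    and sep: "\<And>k. k \<in> I \<Longrightarrow> T k < s \<or> s \<le> T k - int (m k)"
    and ab: "T a < s" "s \<le> T b - int (m b)"
  shows "cumulant W I (\<lambda>k. innov g (m k) (T k)) = 0"
  unfolding cumulant_eq_set_cumulant
proof (rule set_cumulant_indep_eq_0[where A = "{k. T k < s}" and B = "{k. s \<le> T k - int (m k)}"])
  fix C assume C: "C \<subseteq> I"
  have fin: "finite C" "card C \<le> p"
    using I C finite_subset card_mono[OF I(1) C(1)] by auto
  let ?A = "{k. T k < s}" and ?B = "{k. s \<le> T k - int (m k)}" and ?Y = "\<lambda>k. innov g (m k) (T k)"
  have eq: "(\<Prod>k\<in>C. ?Y k \<omega>) = (\<Prod>k\<in>C \<inter> ?A. ?Y k \<omega>) * (\<Prod>k\<in>C \<inter> ?B. ?Y k \<omega>)" for \<omega>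
  proof -
    have "C = (C \<inter> ?A) \<union> (C \<inter> ?B)" using C sep by auto
    moreover have "(C \<inter> ?A) \<inter> (C \<inter> ?B) = {}" by auto
    ultimately show ?thesis using fin by (metis (no_types, lifting) finite_Un prod.union_disjoint)
  qed
  have depA: "depends_on {..<s} (\<lambda>\<omega>. \<Prod>k\<in>C \<inter> ?A. ?Y k \<omega>)"
    by (rule depends_on_prod, rule depends_on_mono[OF depends_on_innov]) auto
  have depB: "depends_on {s..} (\<lambda>\<omega>. \<Prod>k\<in>C \<inter> ?B. ?Y k \<omega>)"
    by (rule depends_on_prod, rule depends_on_mono[OF depends_on_innov]) auto
  have "integrable W (\<lambda>\<omega>. \<Prod>k\<in>C. ?Y k \<omega>)"
    by (intro W.P.integrable_prod_Lp[OF fin] Lp_fun_innov L p)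
  then show "(\<integral>\<omega>. (\<Prod>k\<in>C. ?Y k \<omega>) \<partial>W) = (\<integral>\<omega>. (\<Prod>k\<in>C \<inter> ?A. ?Y k \<omega>) \<partial>W) * (\<integral>\<omega>. (\<Prod>k\<in>C \<inter> ?B. ?Y k \<omega>) \<partial>W)"
    unfolding eq by (rule integral_mult_indep[where i = s]) (rule splice_future[OF depB] splice_past[OF depA]; simp)+
qed (use assms W.P.prob_space in auto)

text \<open>The second claim holds because otherwise the intervals \<open>{i k<..T k}\<close>, of lengths \<open>m k\<close>, would
  leave uncovered some \<open>s\<close> at which the family splits into two independent ones.\<close>

lemma cumulant_innov_nonzero:
  assumes I: "finite I" "I \<noteq> {}" "card I \<le> p" and p: "1 \<le> p"
    and L: "\<And>t. proc g t \<in> Lp_fun W p"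
    and nz: "cumulant W I (\<lambda>k. innov g (m k) (T k)) \<noteq> 0"
  defines "i \<equiv> \<lambda>k. T k - int (m k)"
  shows "\<exists>j\<in>I. \<exists>k\<in>I. j \<noteq> k \<and> i j = i k"
    and "\<And>a b. a \<in> I \<Longrightarrow> b \<in> I \<Longrightarrow> i b - i a \<le> int (\<Sum>k\<in>I. m k)"
proof -
  obtain j where j: "j \<in> I" "\<And>k. k \<in> I \<Longrightarrow> i j \<le> i k"
    using ex_is_arg_min_if_finite[OF I(1,2), of i] by (auto simp: is_arg_min_linorder)
  have "\<exists>k\<in>I. k \<noteq> j \<and> \<not> i j < i k"
  proof (rule ccontr)
    assume "\<not> ?thesis"
    then have "cumulant W I (\<lambda>k. innov g (m k) (T k)) = 0"
      using j by (intro cumulant_innov_unique_min[OF I(1,3) _ p L, of j]) (auto simp: i_def)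
    then show False using nz by simp
  qed
  then obtain k where "k \<in> I" "k \<noteq> j" "\<not> i j < i k" by blast
  then show "\<exists>j\<in>I. \<exists>k\<in>I. j \<noteq> k \<and> i j = i k"
    using j by (metis order.order_iff_strict)
next
  fix a b assume ab: "a \<in> I" "b \<in> I"
  have cover: "{i a<..i b} \<subseteq> (\<Union>l\<in>I. {i l<..T l})"
  proof
    fix s assume s: "s \<in> {i a<..i b}"
    show "s \<in> (\<Union>l\<in>I. {i l<..T l})"
    proof (rule ccontr)
      assume no: "\<not> ?thesis"
      then have "T a < s" using s ab by auto
      then have "cumulant W I (\<lambda>k. innov g (m k) (T k)) = 0"
        \<comment> \<open>A point \<open>s\<close> in none of the intervals has
          \<open>T l < s\<close> or \<open>s \<le> i l\<close> for each \<open>l\<close>. It lies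
          beyond \<open>T a\<close> and not beyond \<open>i b\<close>.\<close>
        using no s ab by (intro cumulant_innov_separated[OF I(1,3) ab p L, of _ s]) (auto simp: i_def not_le)
      then show False using nz by simp
    qed
  qed
  have "card {i a<..i b} \<le> card (\<Union>l\<in>I. {i l<..T l})"
    using I by (intro card_mono[OF _ cover]) auto
  also have "\<dots> \<le> (\<Sum>l\<in>I. card {i l<..T l})" by (rule card_UN_le[OF I(1)])
  also have "\<dots> = (\<Sum>k\<in>I. m k)" by (simp add: i_def)
  finally have "nat (i b - i a) \<le> (\<Sum>k\<in>I. m k)" by simp
  then show "i b - i a \<le> int (\<Sum>k\<in>I. m k)" by (simp only: nat_le_iff)
qed

end

subsection \<open>Counting and summation\<close>

text \<open>The sum is at most \<open>card I\<close> times its largest term, whose power is one of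
  the summands on the right.\<close>

lemma power_sum_le_sum_power:
  fixes x :: "'i \<Rightarrow> real"
  assumes "finite I" "I \<noteq> {}" "\<And>i. i \<in> I \<Longrightarrow> 0 \<le> x i"
  shows "(\<Sum>i\<in>I. x i) ^ q \<le> real (card I) ^ q * (\<Sum>i\<in>I. x i ^ q)"
proof -
  have "Max (x ` I) \<in> x ` I" using assms by (intro Max_in) auto
  then obtain l where l: "l \<in> I" "x l = Max (x ` I)" by auto
  then have le: "x i \<le> x l" if "i \<in> I" for i using assms(1) that by simp
  have "(\<Sum>i\<in>I. x i) \<le> real (card I) * x l"
    using sum_bounded_above[of I x "x l"] le by simp
  then have "(\<Sum>i\<in>I. x i) ^ q \<le> (real (card I) * x l) ^ q"
    using assms(3) by (intro power_mono sum_nonneg) auto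
  also have "\<dots> = real (card I) ^ q * x l ^ q" by (simp add: power_mult_distrib)
  also have "\<dots> \<le> real (card I) ^ q * (\<Sum>i\<in>I. x i ^ q)"
    using assms l by (intro mult_left_mono member_le_sum) auto
  finally show ?thesis .
qed

text \<open>The necessary condition of \<open>cumulant_innov_nonzero\<close> for a nonvanishing cumulant.\<close>

definition compatible :: "nat \<Rightarrow> (nat \<Rightarrow> nat) \<Rightarrow> (nat \<Rightarrow> int) \<Rightarrow> bool" where
  "compatible d m T \<longleftrightarrow>
     (\<exists>j\<in>{0..d}. \<exists>l\<in>{0..d}. j \<noteq> l \<and> T j - int (m j) = T l - int (m l)) \<and>
     (\<forall>a\<in>{0..d}. \<forall>b\<in>{0..d}. (T b - int (m b)) - (T a - int (m a)) \<le> int (\<Sum>k\<in>{0..d}. m k))"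

text \<open>Comparison with index 0, whose time is fixed at 0, confines each \<open>k j\<close> to
  an interval of \<open>2 * S + 1\<close> integers. A coincidence of endpoints then determines one
  coordinate from another or from time 0, leaving \<open>d - 1\<close> free ones. The factor
  \<open>(d + 1)\<^sup>2\<close> bounds the number of coinciding pairs.\<close>

lemma card_compatible:
  fixes m :: "nat \<Rightarrow> nat" and d :: nat
  defines "G \<equiv> {k \<in> {1..d} \<rightarrow>\<^sub>E UNIV. compatible d m (\<lambda>j. if j = 0 then 0 else k j)}"
  shows "finite G" and "card G \<le> (d + 1)\<^sup>2 * (2 * (\<Sum>k\<in>{0..d}. m k) + 1) ^ (d - 1)"
proof -
  define S where "S = (\<Sum>k\<in>{0..d}. m k)"
  \<comment> \<open>The left endpoint \<open>k j - m j\<close> is within \<open>S\<close> of the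
    left endpoint \<open>- m 0\<close> of index 0.\<close>
  define R where "R j = {int (m j) - int (m 0) - int S..int (m j) - int (m 0) + int S}" for j
  have cR: "card (R j) = 2 * S + 1" for j by (simp add: R_def)
  have fR: "finite (R j)" for j by (simp add: R_def)
  define H where "H = (\<lambda>(j, l). {k \<in> Pi\<^sub>E {1..d} R. k l = (if j = 0 then 0 else k j) - int (m j) + int (m l)})"
  \<comment> \<open>The determined index \<open>l\<close> must be positive, since index 0 is not a
    free coordinate; \<open>j\<close> may be 0.\<close>
  define Q where "Q = {(j, l). j \<le> d \<and> 1 \<le> l \<and> l \<le> d \<and> j \<noteq> l}"
  have Qsub: "Q \<subseteq> {0..d} \<times> {0..d}" by (auto simp: Q_def)
  have finQ: "finite Q" by (rule finite_subset[OF Qsub]) simp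
  have cQ: "card Q \<le> (d + 1)\<^sup>2"
    using card_mono[OF _ Qsub] by (simp add: power2_eq_square)
  have finH: "finite (H q)" for q
  proof (rule finite_subset)
    show "H q \<subseteq> Pi\<^sub>E {1..d} R" unfolding H_def by (cases q) auto
    show "finite (Pi\<^sub>E {1..d} R)" using fR by (intro finite_PiE) auto
  qed
  have cH: "card (H q) \<le> (2 * S + 1) ^ (d - 1)" if qQ: "q \<in> Q" for q
  proof -
    obtain j l where q: "q = (j, l)" and jl: "j \<le> d" "1 \<le> l" "l \<le> d" "j \<noteq> l"
      using qQ by (auto simp: Q_def)
    let ?r = "\<lambda>k. restrict k ({1..d} - {l})"
    have "card (H q) \<le> card (Pi\<^sub>E ({1..d} - {l}) R)"
    proof (rule card_inj_on_le[where f = ?r])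
      show "?r ` H q \<subseteq> Pi\<^sub>E ({1..d} - {l}) R"
      proof (rule image_subsetI)
        fix k assume "k \<in> H q"
        then have "k \<in> Pi\<^sub>E {1..d} R" by (simp add: H_def q)
        then show "?r k \<in> Pi\<^sub>E ({1..d} - {l}) R" by (auto simp: PiE_iff)
      qed
      show "finite (Pi\<^sub>E ({1..d} - {l}) R)" using fR by (intro finite_PiE) auto
      show "inj_on ?r (H q)"
      proof (rule inj_onI)
        fix k k' assume k: "k \<in> H q" "k' \<in> H q" and eq: "?r k = ?r k'"
        have agree: "k i = k' i" if "i \<in> {1..d} - {l}" for i
          using fun_cong[OF eq, of i] that by simp
        have "(if j = 0 then 0 else k j) = (if j = 0 then 0 else k' j)"
          using agree[of j] jl by auto
        then have "k l = k' l" using k by (simp add: H_def q)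
        then have "k i = k' i" if "i \<in> {1..d}" for i using agree[of i] that by (cases "i = l") auto
        then show "k = k'" using k by (intro PiE_ext[of k "{1..d}" R]) (simp_all add: H_def q)
      qed
    qed
    also have "\<dots> = (2 * S + 1) ^ (d - 1)"
      using jl by (simp add: card_PiE cR)
    finally show ?thesis .
  qed
  have sub: "G \<subseteq> (\<Union>q\<in>Q. H q)"
  proof
    fix k assume k: "k \<in> G"
    let ?T = "\<lambda>j. if j = 0 then 0 else k j"
    have ext: "k \<in> {1..d} \<rightarrow>\<^sub>E UNIV" and c: "compatible d m ?T" using k by (auto simp: G_def)
    have spread: "(?T b - int (m b)) - (?T a - int (m a)) \<le> int S" if "a \<le> d" "b \<le> d" for a b
      using c that unfolding compatible_def S_def by (metis atLeastAtMost_iff le0)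
    have kR: "k \<in> Pi\<^sub>E {1..d} R"
    proof (rule PiE_I)
      fix j assume j: "j \<in> {1..d}"
      then show "k j \<in> R j" using spread[of 0 j] spread[of j 0] by (auto simp: R_def)
    qed (use ext in \<open>auto simp: PiE_def extensional_def\<close>)
    obtain j l where jl: "j \<le> d" "l \<le> d" "j \<noteq> l" "?T j - int (m j) = ?T l - int (m l)"
      using c unfolding compatible_def by auto
    show "k \<in> (\<Union>q\<in>Q. H q)"
    proof (cases "l = 0")
      case True
      then have "(l, j) \<in> Q" using jl by (auto simp: Q_def)
      moreover have "k \<in> H (l, j)" using kR jl True by (auto simp: H_def)
      ultimately show ?thesis by blast
    next
      case False
      then have "(j, l) \<in> Q" using jl by (auto simp: Q_def)
      moreover have "k \<in> H (j, l)" using kR jl False by (auto simp: H_def)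
      ultimately show ?thesis by blast
    qed
  qed
  have finU: "finite (\<Union>q\<in>Q. H q)" using finQ finH by auto
  show "finite G" using finite_subset[OF sub finU] .
  have "card G \<le> card (\<Union>q\<in>Q. H q)" by (rule card_mono[OF finU sub])
  also have "\<dots> \<le> (\<Sum>q\<in>Q. card (H q))" by (rule card_UN_le[OF finQ])
  also have "\<dots> \<le> (\<Sum>q\<in>Q. (2 * S + 1) ^ (d - 1))" by (rule sum_mono[OF cH])
  also have "\<dots> \<le> (d + 1)\<^sup>2 * (2 * S + 1) ^ (d - 1)" using cQ by simp
  finally show "card G \<le> (d + 1)\<^sup>2 * (2 * (\<Sum>k\<in>{0..d}. m k) + 1) ^ (d - 1)" by (simp add: S_def)
qed

text \<open>For fixed \<open>l\<close> the weight is absorbed into factor \<open>l\<close>, and the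
  sum over \<open>m\<close> becomes a product of one-dimensional sums. Each is at most
  \<open>A\<close> because the weight is at least 1.\<close>

lemma sum_weighted_prod_le:
  fixes a :: "nat \<Rightarrow> real" and I :: "'i set"
  assumes a: "\<And>n. 0 \<le> a n" and sm: "summable (\<lambda>n. (1 + real n) ^ q * a n)"
  defines "A \<equiv> \<Sum>n. (1 + real n) ^ q * a n"
  assumes I: "finite I"
  shows "(\<Sum>m\<in>I \<rightarrow>\<^sub>E {..N}. (\<Prod>j\<in>I. a (m j)) * (\<Sum>l\<in>I. (1 + real (m l)) ^ q)) \<le> real (card I) * A ^ card I"
proof -
  define b where "b j l n = (if j = l then (1 + real n) ^ q * a n else a n)" for j l :: 'i and n
  have ge1: "1 \<le> (1 + real n) ^ q" for n by simp
  have b_nn: "0 \<le> b j l n" and b_le: "b j l n \<le> (1 + real n) ^ q * a n" for j l n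
    using a[of n] mult_right_mono[OF ge1[of n] a[of n]] by (auto simp: b_def)
  have "(\<Sum>m\<in>I \<rightarrow>\<^sub>E {..N}. (\<Prod>j\<in>I. a (m j)) * (\<Sum>l\<in>I. (1 + real (m l)) ^ q)) =
      (\<Sum>l\<in>I. \<Sum>m\<in>I \<rightarrow>\<^sub>E {..N}. (\<Prod>j\<in>I. a (m j)) * (1 + real (m l)) ^ q)"
    by (subst sum.swap) (simp add: sum_distrib_left)
  also have "\<dots> = (\<Sum>l\<in>I. \<Sum>m\<in>I \<rightarrow>\<^sub>E {..N}. \<Prod>j\<in>I. b j l (m j))"
  proof (intro sum.cong refl)
    fix l m assume l: "l \<in> I"
    have "(\<Prod>j\<in>I - {l}. b j l (m j)) = (\<Prod>j\<in>I - {l}. a (m j))"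
      by (intro prod.cong) (auto simp: b_def)
    then show "(\<Prod>j\<in>I. a (m j)) * (1 + real (m l)) ^ q = (\<Prod>j\<in>I. b j l (m j))"
      using I l by (simp add: prod.remove[of I l] b_def)
  qed
  also have "\<dots> = (\<Sum>l\<in>I. \<Prod>j\<in>I. \<Sum>n\<le>N. b j l n)"
    using I by (simp add: prod_sum_PiE)
  also have "\<dots> \<le> (\<Sum>l\<in>I. \<Prod>j\<in>I. A)"
  proof (intro sum_mono prod_mono conjI sum_nonneg b_nn)
    fix l j
    have "(\<Sum>n\<le>N. b j l n) \<le> (\<Sum>n\<le>N. (1 + real n) ^ q * a n)" by (intro sum_mono b_le)
    also have "\<dots> \<le> A" unfolding A_def using a by (intro sum_le_suminf[OF sm]) auto
    finally show "(\<Sum>n\<le>N. b j l n) \<le> A" .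
  qed
  also have "\<dots> = real (card I) * A ^ card I" by simp
  finally show ?thesis .
qed

section \<open>Absolute summability on the sequence space\<close>

context iid_space
begin

text \<open>One constant \<open>B\<close> bounds all finite partial sums. The bound is proved for
  finitely many innovations per variable, uniformly in their number, and passed to the limit by
  \<open>cumulant_tendsto\<close>.\<close>

lemma summable_cumulants_proc:
  fixes g :: "(nat \<Rightarrow> 'e) \<Rightarrow> real" and d :: nat
  assumes g: "g \<in> borel_measurable (PiM UNIV (\<lambda>_. \<mu>))"
    and L: "\<And>t. proc g t \<in> Lp_fun W (d + 1)"
    and mean: "\<And>t. (\<integral>\<omega>. proc g t \<omega> \<partial>W) = 0"
    and dep: "summable (\<lambda>k. real k ^ (d - 1) * phys_dep \<mu> g (d + 1) k)"
  shows "(\<lambda>k. \<bar>cumulant W {0..d} (\<lambda>j. proc g (if j = 0 then 0 else k j))\<bar>)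
    summable_on ({1..d} \<rightarrow>\<^sub>E (UNIV :: int set))"
proof -
  define q where "q = d - 1"
  define \<delta> where "\<delta> = phys_dep \<mu> g (d + 1)"
  \<comment> \<open>The extra summand makes the bound positive, as \<open>abs_cumulant_le\<close> needs.\<close>
  define a where "a n = \<delta> n + 1 / (1 + real n) ^ (q + 2)" for n
  define I where "I = {0..d}"
  have I: "finite I" "I \<noteq> {}" "card I \<le> Suc d" "card I = d + 1" by (auto simp: I_def)
  have \<delta>_nn: "0 \<le> \<delta> n" for n by (simp add: \<delta>_def phys_dep_def)
  have a_pos: "0 < a n" for n using \<delta>_nn[of n] by (simp add: a_def add_nonneg_pos)
  have a_ge: "\<delta> n \<le> a n" for n by (simp add: a_def)
  have sm: "summable (\<lambda>n. (1 + real n) ^ q * a n)"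
  proof -
    have "summable (\<lambda>n. (1 + real n) ^ q * \<delta> n)"
    proof (rule summable_comparison_test_ev)
      show "summable (\<lambda>n. 2 ^ q * (real n ^ q * \<delta> n))"
        using dep unfolding q_def \<delta>_def by (rule summable_mult)
      \<comment> \<open>The comparison \<open>1 + n \<le> 2 * n\<close> starts at n = 1.\<close>
      show "eventually (\<lambda>n. norm ((1 + real n) ^ q * \<delta> n) \<le> 2 ^ q * (real n ^ q * \<delta> n)) sequentially"
        using eventually_ge_at_top[of 1]
      proof eventually_elim
        case (elim n)
        then have "(1 + real n) ^ q \<le> (2 * real n) ^ q" by (intro power_mono) auto
        then have "(1 + real n) ^ q * \<delta> n \<le> (2 * real n) ^ q * \<delta> n" by (rule mult_right_mono[OF _ \<delta>_nn])
        then show ?case using \<delta>_nn[of n] by (simp add: power_mult_distrib mult.assoc)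
      qed
    qed
    \<comment> \<open>The exponent \<open>q + 2\<close> leaves inverse squares after
      weighting.\<close>
    moreover have "summable (\<lambda>n. (1 + real n) ^ q * (1 / (1 + real n) ^ (q + 2)))"
    proof -
      have "summable (\<lambda>n. inverse (real (Suc n) ^ 2))"
        using inverse_power_summable[of 2, where ?'a = real] by (subst summable_Suc_iff) simp
      moreover have "(1 + real n) ^ q * (1 / (1 + real n) ^ (q + 2)) = inverse (real (Suc n) ^ 2)" for n
        by (simp only: power_add of_nat_Suc) (simp add: inverse_eq_divide)
      ultimately show ?thesis by simp
    qed
    ultimately show ?thesis
      unfolding a_def using summable_add by (fastforce simp: distrib_left)
  qed
  define K where "K = cumulant_const I (1 + real (d + 1))"
  have K: "0 \<le> K" unfolding K_def by (intro cumulant_const_nonneg) auto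
  define A where "A = (\<Sum>n. (1 + real n) ^ q * a n)"
  \<comment> \<open>The count in \<open>card_compatible\<close> combined with
    \<open>2 * S + 1 \<le> 2 * (\<Sum>k\<in>I. 1 + m k)\<close> and with the factor
    \<open>(d + 1) ^ q\<close> from \<open>power_sum_le_sum_power\<close>.\<close>
  define c where "c = real ((d + 1)\<^sup>2) * (2 * real (d + 1)) ^ q"
  define B where "B = K * c * (real (card I) * A ^ card I)"
  define T where "T k j = (if j = 0 then 0 else k j)" for k :: "nat \<Rightarrow> int" and j :: nat
  have innov_bound: "\<bar>cumulant W I (\<lambda>j. innov g (m j) (T k j))\<bar> \<le>
      (if compatible d m (T k) then K * (\<Prod>j\<in>I. a (m j)) else 0)" for m k
  proof (cases "cumulant W I (\<lambda>j. innov g (m j) (T k j)) = 0")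
    case True
    have "0 \<le> K * (\<Prod>j\<in>I. a (m j))"
      using K a_pos by (intro mult_nonneg_nonneg prod_nonneg) (auto intro: less_imp_le)
    then show ?thesis using True by simp
  next
    case False
    have "compatible d m (T k)"
      using cumulant_innov_nonzero[OF I(1,2) _ _ L False] I(4) unfolding compatible_def I_def by simp
    moreover have "\<bar>cumulant W I (\<lambda>j. innov g (m j) (T k j))\<bar> \<le> K * (\<Prod>j\<in>I. a (m j))"
      unfolding K_def
    proof (rule W.P.abs_cumulant_le)
      fix j
      show "innov g (m j) (T k j) \<in> Lp_fun W (d + 1)" by (intro Lp_fun_innov L) simp
      have "(\<integral>\<omega>. \<bar>innov g (m j) (T k j) \<omega>\<bar> ^ (d + 1) \<partial>W) \<le> \<delta> (m j) ^ (d + 1)"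
        unfolding \<delta>_def by (intro innov_power_le L g) simp
      also have "\<dots> \<le> a (m j) ^ (d + 1)" by (intro power_mono a_ge \<delta>_nn)
      finally show "(\<integral>\<omega>. \<bar>innov g (m j) (T k j) \<omega>\<bar> ^ (d + 1) \<partial>W) \<le> a (m j) ^ (d + 1)" .
    qed (use I a_pos in auto)
    ultimately show ?thesis by simp
  qed
  have finite_bound: "(\<Sum>k\<in>F. \<bar>cumulant W I (\<lambda>j. proc g (T k j))\<bar>) \<le> B"
    if F: "finite F" "F \<subseteq> {1..d} \<rightarrow>\<^sub>E UNIV" for F
  proof -
    \<comment> \<open>As the means vanish, \<open>sum_innov\<close> identifies this average with the
      sum of the innovations of order at most \<open>N\<close>.\<close>
    define X where "X N k j = avg (T k j - int N) (proc g (T k j))" for N k j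
    have lim: "(\<lambda>N. cumulant W I (X N k)) \<longlonglongrightarrow> cumulant W I (\<lambda>j. proc g (T k j))" for k
    proof (rule W.P.cumulant_tendsto[OF I(1,3)])
      fix j N
      have L': "proc g t \<in> Lp_fun W (Suc d)" for t using L[of t] by simp
      show "proc g (T k j) \<in> Lp_fun W (Suc d)" by (rule L')
      show "X N k j \<in> Lp_fun W (Suc d)"
        and "(\<integral>\<omega>. \<bar>X N k j \<omega>\<bar> ^ Suc d \<partial>W) \<le> (\<integral>\<omega>. \<bar>proc g (T k j) \<omega>\<bar> ^ Suc d \<partial>W)"
        unfolding X_def by (rule Lp_fun_avg[OF L'], simp)+
      show "(\<lambda>N. \<integral>\<omega>. \<bar>X N k j \<omega> - proc g (T k j) \<omega>\<bar> ^ Suc d \<partial>W) \<longlonglongrightarrow> 0"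
        unfolding X_def by (rule avg_tendsto_Lp[OF L']) simp
    qed
    have "(\<lambda>N. \<Sum>k\<in>F. \<bar>cumulant W I (X N k)\<bar>) \<longlonglongrightarrow> (\<Sum>k\<in>F. \<bar>cumulant W I (\<lambda>j. proc g (T k j))\<bar>)"
      by (intro tendsto_sum tendsto_rabs lim)
    moreover have "(\<Sum>k\<in>F. \<bar>cumulant W I (X N k)\<bar>) \<le> B" for N
    proof -
      have "\<bar>cumulant W I (X N k)\<bar> \<le> (\<Sum>m\<in>I \<rightarrow>\<^sub>E {..N}. if compatible d m (T k) then K * (\<Prod>j\<in>I. a (m j)) else 0)" for k
      proof -
        have "X N k = (\<lambda>j \<omega>. \<Sum>n\<le>N. innov g n (T k j) \<omega>)"
          by (simp add: X_def sum_innov mean fun_eq_iff)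
        then have "cumulant W I (X N k) = (\<Sum>m\<in>I \<rightarrow>\<^sub>E {..N}. cumulant W I (\<lambda>j. innov g (m j) (T k j)))"
          using L by (simp only:) (rule W.P.cumulant_multilinear[OF I(1,3)], simp add: Lp_fun_innov)
        then show ?thesis
          by (simp only:) (rule order.trans[OF sum_abs], rule sum_mono, rule innov_bound)
      qed
      then have "(\<Sum>k\<in>F. \<bar>cumulant W I (X N k)\<bar>) \<le>
          (\<Sum>k\<in>F. \<Sum>m\<in>I \<rightarrow>\<^sub>E {..N}. if compatible d m (T k) then K * (\<Prod>j\<in>I. a (m j)) else 0)"
        by (intro sum_mono)
      \<comment> \<open>For fixed \<open>m\<close> the bound is the same for all compatible
        \<open>k\<close>, so the inner sum only counts them.\<close>
      also have "\<dots> = (\<Sum>m\<in>I \<rightarrow>\<^sub>E {..N}. \<Sum>k\<in>F. if compatible d m (T k) then K * (\<Prod>j\<in>I. a (m j)) else 0)"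
        by (rule sum.swap)
      also have "\<dots> = (\<Sum>m\<in>I \<rightarrow>\<^sub>E {..N}. real (card {k \<in> F. compatible d m (T k)}) * (K * (\<Prod>j\<in>I. a (m j))))"
        using F by (simp add: sum.If_cases Int_def)
      also have "\<dots> \<le> (\<Sum>m\<in>I \<rightarrow>\<^sub>E {..N}. (c * (\<Sum>l\<in>I. (1 + real (m l)) ^ q)) * (K * (\<Prod>j\<in>I. a (m j))))"
      proof (intro sum_mono mult_right_mono)
        fix m
        show "0 \<le> K * (\<Prod>j\<in>I. a (m j))"
          using K a_pos by (intro mult_nonneg_nonneg prod_nonneg) (auto intro: less_imp_le)
        let ?G = "{k \<in> {1..d} \<rightarrow>\<^sub>E UNIV. compatible d m (T k)}"
        have "card {k \<in> F. compatible d m (T k)} \<le> card ?G"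
          using card_compatible(1)[of d m] F by (intro card_mono) (auto simp: T_def[abs_def])
        also have "\<dots> \<le> (d + 1)\<^sup>2 * (2 * (\<Sum>k\<in>I. m k) + 1) ^ q"
          using card_compatible(2)[of d m] by (simp add: T_def[abs_def] I_def q_def)
        finally have "real (card {k \<in> F. compatible d m (T k)}) \<le> real ((d + 1)\<^sup>2 * (2 * (\<Sum>k\<in>I. m k) + 1) ^ q)"
          by (simp only: of_nat_le_iff)
        also have "\<dots> = real ((d + 1)\<^sup>2) * (2 * (\<Sum>k\<in>I. real (m k)) + 1) ^ q" by (simp add: add.commute)
        also have "\<dots> \<le> real ((d + 1)\<^sup>2) * (2 * (\<Sum>k\<in>I. 1 + real (m k))) ^ q"
          using I by (intro mult_left_mono power_mono) (auto simp: sum.distrib intro!: add_nonneg_nonneg sum_nonneg)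
        also have "\<dots> \<le> real ((d + 1)\<^sup>2) * (2 ^ q * (real (d + 1) ^ q * (\<Sum>k\<in>I. (1 + real (m k)) ^ q)))"
          using power_sum_le_sum_power[OF I(1,2), of "\<lambda>k. 1 + real (m k)" q] I(4)
          by (simp add: power_mult_distrib mult_left_mono)
        also have "\<dots> = c * (\<Sum>l\<in>I. (1 + real (m l)) ^ q)"
          by (simp only: c_def power_mult_distrib mult.assoc)
        finally show "real (card {k \<in> F. compatible d m (T k)}) \<le> c * (\<Sum>l\<in>I. (1 + real (m l)) ^ q)" .
      qed
      also have "\<dots> = K * c * (\<Sum>m\<in>I \<rightarrow>\<^sub>E {..N}. (\<Prod>j\<in>I. a (m j)) * (\<Sum>l\<in>I. (1 + real (m l)) ^ q))"
        by (simp add: sum_distrib_left mult_ac)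
      also have "\<dots> \<le> B"
        unfolding B_def A_def using K a_pos
        by (intro mult_left_mono sum_weighted_prod_le sm I) (auto simp: c_def intro: less_imp_le)
      finally show ?thesis .
    qed
    ultimately show ?thesis by (intro LIMSEQ_le_const2) auto
  qed
  have "(\<lambda>k. \<bar>cumulant W I (\<lambda>j. proc g (T k j))\<bar>) summable_on ({1..d} \<rightarrow>\<^sub>E UNIV)"
  proof (rule nonneg_bdd_above_summable_on)
    show "bdd_above (sum (\<lambda>k. \<bar>cumulant W I (\<lambda>j. proc g (T k j))\<bar>) ` {F. F \<subseteq> {1..d} \<rightarrow>\<^sub>E UNIV \<and> finite F})"
      by (rule bdd_aboveI2[where M = B]) (use finite_bound in auto)
  qed simp
  then show ?thesis by (simp add: T_def I_def)
qed

end

section \<open>Transfer to the given probability space\<close>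

theorem theorem5:
  fixes M :: "'a measure" and E :: "'e measure"
    and \<epsilon> :: "int \<Rightarrow> 'a \<Rightarrow> 'e" and g :: "(nat \<Rightarrow> 'e) \<Rightarrow> real"
    and X :: "int \<Rightarrow> 'a \<Rightarrow> real" and d :: nat
  assumes "prob_space M"
    and "d \<ge> 2"
    and eps_rv: "\<And>i. \<epsilon> i \<in> measurable M E"
    and eps_indep: "prob_space.indep_vars M (\<lambda>_. E) \<epsilon> UNIV"
    and eps_ident: "\<And>i. distr M E (\<epsilon> i) = distr M E (\<epsilon> 0)"
    and g_meas: "g \<in> borel_measurable (PiM (UNIV :: nat set) (\<lambda>_. E))"
    and X_def: "\<And>i \<omega>. X i \<omega> = g (\<lambda>j. \<epsilon> (i - int j) \<omega>)"
    and X_Lp: "\<And>i. integrable M (\<lambda>\<omega>. \<bar>X i \<omega>\<bar> ^ (d + 1))"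
    and X_mean: "\<And>i. (\<integral>\<omega>. X i \<omega> \<partial>M) = 0"
    and dep_sum: "summable (\<lambda>k. real k ^ (d - 1) * phys_dep (distr M E (\<epsilon> 0)) g (d + 1) k)"
  shows "(\<lambda>k. \<bar>cumulant M {0..d} (\<lambda>j. X (if j = 0 then 0 else k j))\<bar>)
           summable_on ({1..d} \<rightarrow>\<^sub>E (UNIV :: int set))"
proof -
  interpret M: prob_space M by fact
  define \<mu> where "\<mu> = distr M E (\<epsilon> 0)"
  have sets_\<mu>: "sets \<mu> = sets E" by (simp add: \<mu>_def)
  interpret S: iid_space \<mu>
    unfolding iid_space_def \<mu>_def by (rule M.prob_space_distr[OF eps_rv])
  let ?W = "PiM (UNIV :: int set) (\<lambda>_. \<mu>)"
  let ?e = "\<lambda>\<omega> i. \<epsilon> i \<omega>"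
  have sets_W: "sets ?W = sets (PiM UNIV (\<lambda>_. E))"
    by (intro sets_PiM_cong refl sets_\<mu>)
  \<comment> \<open>Independence and equal laws say that the whole innovation sequence has the
    product law, so every moment in the cumulant can be computed on the sequence space.
    \<open>\<mu>\<close> and \<open>E\<close> have the same measurable sets.\<close>
  have "distr M (PiM UNIV (\<lambda>_. E)) (\<lambda>\<omega>. \<lambda>i\<in>UNIV. \<epsilon> i \<omega>) = PiM UNIV (\<lambda>i. distr M E (\<epsilon> i))"
    using eps_indep M.indep_vars_iff_distr_eq_PiM'[where I = UNIV and M' = "\<lambda>_. E" and X = \<epsilon>] eps_rv by simp
  also have "PiM UNIV (\<lambda>i. distr M E (\<epsilon> i)) = ?W"
    unfolding \<mu>_def by (intro PiM_cong refl eps_ident)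
  finally have distr_e: "distr M ?W ?e = ?W"
    using distr_cong[OF refl sets_W, of M ?e ?e] by (simp add: restrict_def)
  have e_meas: "?e \<in> measurable M ?W"
    unfolding measurable_cong_sets[OF refl sets_W]
    using eps_rv by (intro measurable_PiM_single') (auto dest: measurable_space)
  have g': "g \<in> borel_measurable (PiM UNIV (\<lambda>_. \<mu>))"
    using g_meas measurable_cong_sets[OF sets_PiM_cong[OF refl sets_\<mu>] refl] by blast
  have proc_meas: "S.proc g t \<in> borel_measurable ?W" for t
    unfolding S.proc_def
  proof (rule measurable_compose[OF _ g'])
    show "(\<lambda>\<omega> j. \<omega> (t - int j)) \<in> measurable ?W (PiM UNIV (\<lambda>_. \<mu>))"
      by (rule measurable_PiM_single') (auto simp: space_PiM PiE_iff)
  qed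
  have X_eq: "X t \<omega> = S.proc g t (?e \<omega>)" for t \<omega>
    by (simp add: X_def S.proc_def)
  have transfer: "(\<integral>\<omega>. f (?e \<omega>) \<partial>M) = (\<integral>\<omega>. f \<omega> \<partial>?W)" if "f \<in> borel_measurable ?W" for f :: "_ \<Rightarrow> real"
    using integral_distr[OF e_meas that] by (simp add: distr_e)
  have "integrable ?W (\<lambda>\<omega>. \<bar>S.proc g t \<omega>\<bar> ^ (d + 1))" for t
    using X_Lp[of t] integrable_distr_eq[OF e_meas, of "\<lambda>\<omega>. \<bar>S.proc g t \<omega>\<bar> ^ (d + 1)"] proc_meas[of t]
    by (simp add: X_eq distr_e)
  then have L: "S.proc g t \<in> Lp_fun ?W (d + 1)" for t
    using proc_meas by (simp add: Lp_fun_def)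
  have mean: "(\<integral>\<omega>. S.proc g t \<omega> \<partial>?W) = 0" for t
    using X_mean[of t] transfer[OF proc_meas[of t]] by (simp add: X_eq)
  have "cumulant M {0..d} (\<lambda>j. X (if j = 0 then 0 else k j)) =
      cumulant ?W {0..d} (\<lambda>j. S.proc g (if j = 0 then 0 else k j))" for k
    unfolding cumulant_def X_eq
    by (intro sum.cong prod.cong arg_cong2[where f = "(*)"] refl transfer borel_measurable_prod proc_meas)
  then show ?thesis
    using S.summable_cumulants_proc[OF g' L mean] dep_sum by (simp add: \<mu>_def)
qed

end
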